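(* Let $A\in\mathfrak{her}_N$, let $P:=(P_1,\dots,P_r)\in\mathrm{Gr}^{\times r}(\mathbf m,\mathbf n)$ and let $\rho_A:\mathrm{Gr}^{\times r}(\mathbf m,\mathbf n)\to\mathbb{R}$, $\rho_A(P_1,\dots,P_r)=\operatorname{tr}\big(A(P_1\otimes\cdots\otimes P_r)\big)$, be the generalized Rayleigh-quotient. For $j=1,\dots,r$ let $\widehat A_j\in\mathfrak{her}_{n_j}$ be the matrix associated with $A$ and $P$ as defined in the context. Then: (i) The gradient of $\rho_A$ at $P$ with respect to the Riemannian metric induced by $\langle (X_1,\dots,X_r),(Y_1,\dots,Y_r)\rangle=\sum_{j=1}^r\operatorname{tr}(X_jY_j)$ is $$\operatorname{grad}\rho_A(P)=\big(\mathrm{ad}^2_{P_1}\widehat A_1,\dots,\mathrm{ad}^2_{P_r}\widehat A_r\big).$$ (ii) $P$ is a critical point of $\rho_A$ on $\mathrm{Gr}^{\times r}(\mathbf m,\mathbf n)$ if and only if $$[P_j,\widehat A_j]=0\quad\text{for all } j=1,\dots,r,$$ i.e. if and only if for each $j$, $P_j$ is the orthogonal projector onto an $m_j$-dimensional invariant subspace of $\widehat A_j$.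
   Context: Let $r\ge 1$, $1\le m_j\le n_j$ be integers for $j=1,\dots,r$, $N:=n_1\cdots n_r$, $(\mathbf m,\mathbf n):=((m_1,n_1),\dots,(m_r,n_r))$. $\mathfrak{her}_n$ is the real vector space of Hermitian $n\times n$ complex matrices. $\mathrm{Gr}_{m,n}:=\{P\in\mathbb{C}^{n\times n}\mid P=P^\dagger=P^2,\ \operatorname{tr}P=m\}$, a smooth submanifold of $\mathfrak{her}_n$, and $\mathrm{Gr}^{\times r}(\mathbf m,\mathbf n):=\mathrm{Gr}_{m_1,n_1}\times\cdots\times\mathrm{Gr}_{m_r,n_r}\subset\mathfrak{her}_{n_1}\times\cdots\times\mathfrak{her}_{n_r}$, with the Riemannian metric induced by $\langle (X_j),(Y_j)\rangle=\sum_j\operatorname{tr}(X_jY_j)$. $\otimes$ of matrices is the Kronecker product. $[X,Y]=XY-YX$, $\mathrm{ad}_XY=[X,Y]$, $\mathrm{ad}_P^2X=[P,[P,X]]$. $\widehat A_j$ is the unique $n_j\times n_j$ matrix (it is Hermitian) such that $\operatorname{tr}\big(A(P_1\otimes\cdots\otimes P_{j-1}\otimes Z\otimes P_{j+1}\otimes\cdots\otimes P_r)\big)=\operatorname{tr}(\widehat A_jZ)$ for all $Z\in\mathbb{C}^{n_j\times n_j}$. The Riemannian gradient $\operatorname{grad} f(P)$ is the unique tangent vector at $P$ with $\mathrm{d}f(P)(\xi)=\langle\operatorname{grad}f(P),\xi\rangle$ for all tangent vectors $\xi$ at $P$. *)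

theory Defs
  imports
    "HOL-Analysis.Derivative"
    "Jordan_Normal_Form.Schur_Decomposition"
    "Jordan_Normal_Form.VS_Connect"
begin

text \<open>
  Matrices are those of \<^theory>\<open>Jordan_Normal_Form.Matrix\<close>, whose dimensions are values rather than
  types, since the factors may have pairwise different sizes.  An $r$-tuple of matrices is a list of
  length \<open>r\<close>; its components, and the size functions \<open>m, n :: nat \<Rightarrow> nat\<close>, are indexed from \<open>0\<close>
  to \<open>r - 1\<close>.
\<close>

section \<open>Matrices\<close>

definition mtrace :: "complex mat \<Rightarrow> complex" where
  "mtrace A = (\<Sum>i<dim_row A. A $$ (i, i))"

definition her :: "nat \<Rightarrow> complex mat set" where
  "her n = {X \<in> carrier_mat n n. mat_adjoint X = X}"

definition commutator :: "complex mat \<Rightarrow> complex mat \<Rightarrow> complex mat" where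
  "commutator X Y = X * Y - Y * X"

definition ad2 :: "complex mat \<Rightarrow> complex mat \<Rightarrow> complex mat" where
  "ad2 P X = commutator P (commutator P X)"

definition kron :: "complex mat \<Rightarrow> complex mat \<Rightarrow> complex mat" where
  "kron A B = mat (dim_row A * dim_row B) (dim_col A * dim_col B)
     (\<lambda>(i, j). A $$ (i div dim_row B, j div dim_col B) * B $$ (i mod dim_row B, j mod dim_col B))"

fun kron_list :: "complex mat list \<Rightarrow> complex mat" where
  "kron_list [] = 1\<^sub>m 1"
| "kron_list (P # Ps) = kron P (kron_list Ps)"

section \<open>Products of Grassmannians\<close>

definition Gr :: "nat \<Rightarrow> nat \<Rightarrow> complex mat set" where
  "Gr m n = {P \<in> carrier_mat n n. mat_adjoint P = P \<and> P * P = P \<and> mtrace P = of_nat m}"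

definition her_prod :: "nat \<Rightarrow> (nat \<Rightarrow> nat) \<Rightarrow> complex mat list set" where
  "her_prod r n = {Xs. length Xs = r \<and> (\<forall>j<r. Xs ! j \<in> her (n j))}"

definition Gr_prod :: "nat \<Rightarrow> (nat \<Rightarrow> nat) \<Rightarrow> (nat \<Rightarrow> nat) \<Rightarrow> complex mat list set" where
  "Gr_prod r m n = {Ps. length Ps = r \<and> (\<forall>j<r. Ps ! j \<in> Gr (m j) (n j))}"

text \<open>On Hermitian tuples the traces below are already real (see \<open>mtrace_mult_her_real\<close>).\<close>

definition her_inner :: "complex mat list \<Rightarrow> complex mat list \<Rightarrow> real" where
  "her_inner Xs Ys = (\<Sum>j<length Xs. Re (mtrace (Xs ! j * Ys ! j)))"

section \<open>Differential calculus on subsets of the space of Hermitian tuples\<close>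

text \<open>
  In the following, \<open>M\<close> is a submanifold of the real vector space \<open>her_prod r n\<close>.
  Tangent vectors at \<open>P\<close> are the velocities at time \<open>0\<close> of continuously differentiable curves in \<open>M\<close>
  through \<open>P\<close>; differentiability of a matrix-valued curve is entrywise.
\<close>

definition curve_with_velocity ::
  "nat \<Rightarrow> (nat \<Rightarrow> nat) \<Rightarrow> complex mat list set \<Rightarrow> complex mat list \<Rightarrow> complex mat list
     \<Rightarrow> (real \<Rightarrow> complex mat list) \<Rightarrow> bool" where
  "curve_with_velocity r n M P \<xi> \<gamma> \<longleftrightarrow>
     (\<exists>\<epsilon>>0. (\<forall>t\<in>{-\<epsilon><..<\<epsilon>}. \<gamma> t \<in> M) \<and>
        (\<forall>j<r. \<forall>a<n j. \<forall>b<n j. (\<lambda>t. (\<gamma> t ! j) $$ (a, b)) C1_differentiable_on {-\<epsilon><..<\<epsilon>})) \<and>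
     \<gamma> 0 = P \<and>
     (\<forall>j<r. \<forall>a<n j. \<forall>b<n j.
        ((\<lambda>t. (\<gamma> t ! j) $$ (a, b)) has_vector_derivative (\<xi> ! j) $$ (a, b)) (at 0))"

definition tangent_space ::
  "nat \<Rightarrow> (nat \<Rightarrow> nat) \<Rightarrow> complex mat list set \<Rightarrow> complex mat list \<Rightarrow> complex mat list set" where
  "tangent_space r n M P = {\<xi> \<in> her_prod r n. \<exists>\<gamma>. curve_with_velocity r n M P \<xi> \<gamma>}"

text \<open>The value of $\mathrm{d}f(P)$ at the tangent vector \<open>\<xi>\<close> is \<open>d\<close>:\<close>

definition has_differential ::
  "nat \<Rightarrow> (nat \<Rightarrow> nat) \<Rightarrow> complex mat list set \<Rightarrow> (complex mat list \<Rightarrow> real)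
     \<Rightarrow> complex mat list \<Rightarrow> complex mat list \<Rightarrow> real \<Rightarrow> bool" where
  "has_differential r n M f P \<xi> d \<longleftrightarrow>
     (\<forall>\<gamma>. curve_with_velocity r n M P \<xi> \<gamma> \<longrightarrow> ((\<lambda>t. f (\<gamma> t)) has_real_derivative d) (at 0))"

definition is_gradient ::
  "nat \<Rightarrow> (nat \<Rightarrow> nat) \<Rightarrow> complex mat list set \<Rightarrow> (complex mat list \<Rightarrow> real)
     \<Rightarrow> complex mat list \<Rightarrow> complex mat list \<Rightarrow> bool" where
  "is_gradient r n M f P G \<longleftrightarrow>
     G \<in> tangent_space r n M P \<and>
     (\<forall>\<xi>\<in>tangent_space r n M P. has_differential r n M f P \<xi> (her_inner G \<xi>))"

definition grad ::
  "nat \<Rightarrow> (nat \<Rightarrow> nat) \<Rightarrow> complex mat list set \<Rightarrow> (complex mat list \<Rightarrow> real)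
     \<Rightarrow> complex mat list \<Rightarrow> complex mat list" where
  "grad r n M f P = (THE G. is_gradient r n M f P G)"

definition critical_point ::
  "nat \<Rightarrow> (nat \<Rightarrow> nat) \<Rightarrow> complex mat list set \<Rightarrow> (complex mat list \<Rightarrow> real)
     \<Rightarrow> complex mat list \<Rightarrow> bool" where
  "critical_point r n M f P \<longleftrightarrow>
     P \<in> M \<and> (\<forall>\<xi>\<in>tangent_space r n M P. has_differential r n M f P \<xi> 0)"

section \<open>The generalized Rayleigh quotient\<close>

text \<open>For Hermitian arguments the trace below is already real (see \<open>rayleigh_eq_mtrace\<close>).\<close>

definition rayleigh :: "complex mat \<Rightarrow> complex mat list \<Rightarrow> real" where
  "rayleigh A Ps = Re (mtrace (A * kron_list Ps))"

definition A_hat :: "complex mat \<Rightarrow> complex mat list \<Rightarrow> nat \<Rightarrow> complex mat" where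
  "A_hat A Ps j = (THE B. B \<in> carrier_mat (dim_row (Ps ! j)) (dim_row (Ps ! j)) \<and>
     (\<forall>Z \<in> carrier_mat (dim_row (Ps ! j)) (dim_row (Ps ! j)).
        mtrace (A * kron_list (Ps[j := Z])) = mtrace (B * Z)))"

section \<open>Invariant subspaces and orthogonal projectors\<close>

definition vec_subspace_of_dim :: "nat \<Rightarrow> nat \<Rightarrow> complex vec set \<Rightarrow> bool" where
  "vec_subspace_of_dim n k W \<longleftrightarrow>
     subspace class_ring W (module_vec TYPE(complex) n) \<and>
     vectorspace.dim class_ring ((module_vec TYPE(complex) n)\<lparr>carrier := W\<rparr>) = k"

definition invariant_subspace :: "complex mat \<Rightarrow> complex vec set \<Rightarrow> bool" where
  "invariant_subspace B W \<longleftrightarrow> (\<forall>w\<in>W. B *\<^sub>v w \<in> W)"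

definition orthogonal_projector_onto :: "nat \<Rightarrow> complex mat \<Rightarrow> complex vec set \<Rightarrow> bool" where
  "orthogonal_projector_onto n P W \<longleftrightarrow> P \<in> carrier_mat n n \<and>
     (\<forall>v\<in>carrier_vec n. P *\<^sub>v v \<in> W \<and> (\<forall>w\<in>W. (v - P *\<^sub>v v) \<bullet>c w = 0))"

section \<open>The traces are real\<close>

lemma mat_adjoint_index:
  "i < dim_col X \<Longrightarrow> j < dim_row X \<Longrightarrow> mat_adjoint X $$ (i, j) = cnj (X $$ (j, i))"
  by (simp add: mat_adjoint_def mat_of_rows_def)

lemma her_index: "X \<in> her n \<Longrightarrow> i < n \<Longrightarrow> j < n \<Longrightarrow> X $$ (j, i) = cnj (X $$ (i, j))"
  using mat_adjoint_index[of j X i] by (auto simp: her_def)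

lemma her_iff: "X \<in> her n \<longleftrightarrow> X \<in> carrier_mat n n \<and> (\<forall>i<n. \<forall>j<n. X $$ (j, i) = cnj (X $$ (i, j)))"
proof
  assume X: "X \<in> her n"
  have "X \<in> carrier_mat n n" using X by (simp add: her_def)
  with her_index[OF X] show "X \<in> carrier_mat n n \<and> (\<forall>i<n. \<forall>j<n. X $$ (j, i) = cnj (X $$ (i, j)))"
    by blast
next
  assume *: "X \<in> carrier_mat n n \<and> (\<forall>i<n. \<forall>j<n. X $$ (j, i) = cnj (X $$ (i, j)))"
  then have d: "dim_row X = n" "dim_col X = n" by auto
  have "mat_adjoint X = X"
  proof (rule eq_matI)
    fix i j assume ij: "i < dim_row X" "j < dim_col X"
    then have "mat_adjoint X $$ (i, j) = cnj (X $$ (j, i))"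
      using d by (simp add: mat_adjoint_index)
    also have "\<dots> = X $$ (i, j)" using * ij d by metis
    finally show "mat_adjoint X $$ (i, j) = X $$ (i, j)" .
  qed (simp_all add: d mat_adjoint_def)
  with * show "X \<in> her n" by (simp add: her_def)
qed

lemma mtrace_mult_her_real:
  assumes "X \<in> her n" "Y \<in> her n"
  shows "complex_of_real (Re (mtrace (X * Y))) = mtrace (X * Y)"
proof -
  have d: "dim_row X = n" "dim_col X = n" "dim_row Y = n" "dim_col Y = n"
    using assms by (auto simp: her_def)
  have tr: "mtrace (X * Y) = (\<Sum>i<n. \<Sum>k<n. X $$ (i, k) * Y $$ (k, i))"
    by (simp add: mtrace_def d scalar_prod_def lessThan_atLeast0)
  have "cnj (mtrace (X * Y)) = (\<Sum>i<n. \<Sum>k<n. X $$ (k, i) * Y $$ (i, k))"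
    unfolding tr cnj_sum complex_cnj_mult
    by (intro sum.cong refl arg_cong2[where f = "(*)"])
       (simp_all add: her_index[OF assms(1), symmetric] her_index[OF assms(2), symmetric])
  also have "\<dots> = mtrace (X * Y)" unfolding tr by (rule sum.swap)
  finally show ?thesis by (simp add: complex_eq_iff)
qed

lemma kron_her:
  assumes "X \<in> her a" "Y \<in> her b"
  shows "kron X Y \<in> her (a * b)"
proof -
  have d: "dim_row X = a" "dim_col X = a" "dim_row Y = b" "dim_col Y = b"
    using assms by (auto simp: her_def)
  have "kron X Y $$ (j, i) = cnj (kron X Y $$ (i, j))" if "i < a * b" "j < a * b" for i j
  proof -
    have "b > 0" using that by (cases b) auto
    then have "i div b < a" "j div b < a" "i mod b < b" "j mod b < b"
      using that by (auto simp: less_mult_imp_div_less)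
    then have "X $$ (j div b, i div b) = cnj (X $$ (i div b, j div b))"
      "Y $$ (j mod b, i mod b) = cnj (Y $$ (i mod b, j mod b))"
      using assms by (auto intro: her_index)
    then show ?thesis using that by (simp add: kron_def d)
  qed
  then show ?thesis by (auto simp: her_iff kron_def d)
qed

lemma kron_list_her:
  "Xs \<in> her_prod r n \<Longrightarrow> kron_list Xs \<in> her (\<Prod>j<r. n j)"
proof (induction Xs arbitrary: r n)
  case Nil
  then show ?case by (auto simp: her_prod_def her_iff)
next
  case (Cons X Xs)
  then obtain s where s: "r = Suc s" by (cases r) (auto simp: her_prod_def)
  from Cons.prems s have X: "X \<in> her (n 0)" and Xs: "Xs \<in> her_prod s (\<lambda>j. n (Suc j))"
    by (auto simp: her_prod_def)
  have "(\<Prod>j<r. n j) = n 0 * (\<Prod>j<s. n (Suc j))"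
    unfolding s by (rule prod.lessThan_Suc_shift)
  with kron_her[OF X Cons.IH[OF Xs]] show ?case by simp
qed

lemma rayleigh_eq_mtrace:
  assumes "A \<in> her (\<Prod>j<r. n j)" "Ps \<in> her_prod r n"
  shows "complex_of_real (rayleigh A Ps) = mtrace (A * kron_list Ps)"
  unfolding rayleigh_def by (rule mtrace_mult_her_real[OF assms(1) kron_list_her[OF assms(2)]])

end

(*
  Differentiating P^2 = P shows that a tangent vector X at P satisfies P X + X P = X, hence
  ad_P^2 X = X; conversely every Hermitian X with P X + X P = X is the velocity of the curve
  (1 + t^2 X^2)^(-1) (P + t X + t^2 X P X) of projectors.  Since the Kronecker product is
  multilinear, the derivative of the Rayleigh quotient in direction X is
  sum_j tr(A_hat_j X_j) = sum_j tr(A_hat_j ad_{P_j}^2 X_j) = sum_j tr(ad_{P_j}^2 A_hat_j X_j),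
  and ad_{P_j}^2 A_hat_j is itself tangent, so it is the gradient.  It vanishes iff
  [P_j, A_hat_j] = P_j ad^2 - ad^2 P_j does, that is, iff the range of P_j is A_hat_j-invariant.
*)

theory Submission
  imports Defs "Jordan_Normal_Form.DL_Rank"
begin

section \<open>Traces and adjoints\<close>

text \<open>The delicate point is that the candidate gradient must itself be a velocity.
  \<open>tangent_space\<close> consists of velocities of curves, and both the uniqueness of the
  gradient and the criterion for critical points test against the gradient itself, where positive
  definiteness of \<open>her_inner\<close> decides. So a C1 curve with prescribed velocity X has to
  be exhibited. The usual choice would be the conjugation exp(t[X,P]) P exp(-t[X,P]); the projectors
  onto the ranges of (1 + tX)P are taken instead because, by Cramer's rule, their entries are
  quotients of polynomials in t, and differentiability reduces to the scalar quotient rule. In block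
  form relative to range and kernel of P, tangent vectors are the Hermitian matrices with zero
  diagonal blocks, and ad_P^2 erases the diagonal blocks: it is the orthogonal projection onto the
  tangent space. \<open>A_hat\<close> is given only by a trace identity, so its uniqueness and its
  Hermitian symmetry are read off from test matrices supported on two entries.\<close>

lemma mat_mult_index:
  assumes "A \<in> carrier_mat l k" "B \<in> carrier_mat k n" "i < l" "j < n"
  shows "(A * B) $$ (i, j) = (\<Sum>h<k. A $$ (i, h) * B $$ (h, j))"
  using assms by (auto simp: scalar_prod_def lessThan_atLeast0 intro!: sum.cong)

lemma mtrace_mult:
  assumes "A \<in> carrier_mat n k" "B \<in> carrier_mat k n"
  shows "mtrace (A * B) = (\<Sum>i<n. \<Sum>j<k. A $$ (i, j) * B $$ (j, i))"
  using assms by (auto simp: mtrace_def scalar_prod_def lessThan_atLeast0 intro!: sum.cong)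

lemma mtrace_mult_commute:
  assumes "A \<in> carrier_mat n k" "B \<in> carrier_mat k n"
  shows "mtrace (A * B) = mtrace (B * A)"
  unfolding mtrace_mult[OF assms] mtrace_mult[OF assms(2,1)]
  by (subst sum.swap) (simp only: mult.commute)

lemma mtrace_minus:
  "A \<in> carrier_mat n n \<Longrightarrow> B \<in> carrier_mat n n \<Longrightarrow> mtrace (A - B) = mtrace A - mtrace B"
  by (simp add: mtrace_def sum_subtractf)

lemma mtrace_one: "mtrace (1\<^sub>m n) = of_nat n"
  by (simp add: mtrace_def)

lemma dim_mat_adjoint [simp]: "dim_row (mat_adjoint A) = dim_col A" "dim_col (mat_adjoint A) = dim_row A"
  by (simp_all add: mat_adjoint_def)

lemma mat_adjoint_carrier: "A \<in> carrier_mat m n \<Longrightarrow> mat_adjoint A \<in> carrier_mat n m"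
  by (auto simp: mat_adjoint_def)

lemma mat_adjoint_mult:
  assumes A: "A \<in> carrier_mat l m" and B: "B \<in> carrier_mat m n"
  shows "mat_adjoint (A * B) = mat_adjoint B * mat_adjoint (A :: complex mat)"
proof (rule eq_matI)
  note AB = mat_adjoint_carrier[OF A] mat_adjoint_carrier[OF B]
  fix i j assume "i < dim_row (mat_adjoint B * mat_adjoint A)" "j < dim_col (mat_adjoint B * mat_adjoint A)"
  then have ij: "i < n" "j < l" using AB by auto
  then show "mat_adjoint (A * B) $$ (i, j) = (mat_adjoint B * mat_adjoint A) $$ (i, j)"
    using A B AB
    by (subst mat_adjoint_index)
      (auto simp: scalar_prod_def cnj_sum mat_adjoint_index mult.commute intro!: sum.cong)
qed (use A B in \<open>auto simp: mat_adjoint_def\<close>)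

lemma mat_adjoint_add:
  "A \<in> carrier_mat m n \<Longrightarrow> B \<in> carrier_mat m n \<Longrightarrow>
    mat_adjoint (A + B) = mat_adjoint A + mat_adjoint (B :: complex mat)"
  by (rule eq_matI) (auto simp: mat_adjoint_index)

lemma mat_adjoint_minus:
  "A \<in> carrier_mat m n \<Longrightarrow> B \<in> carrier_mat m n \<Longrightarrow>
    mat_adjoint (A - B) = mat_adjoint A - mat_adjoint (B :: complex mat)"
  by (rule eq_matI) (auto simp: mat_adjoint_index)

lemma mat_adjoint_one: "mat_adjoint (1\<^sub>m n :: complex mat) = 1\<^sub>m n"
  by (rule eq_matI) (auto simp: mat_adjoint_index)

lemma her_carrier: "X \<in> her n \<Longrightarrow> X \<in> carrier_mat n n"
  by (simp add: her_def)

lemma her_minus: "X \<in> her n \<Longrightarrow> Y \<in> her n \<Longrightarrow> X - Y \<in> her n"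
  by (simp add: her_def mat_adjoint_minus[of _ n n] minus_carrier_mat)

lemma Gr_imp_her: "P \<in> Gr m n \<Longrightarrow> P \<in> her n"
  by (simp add: Gr_def her_def)

section \<open>Tangent vectors of the Grassmannian\<close>

context
  fixes n :: nat
begin

text \<open>With every dimension fixed to \<open>n\<close>, no dimension variable stays open in the
  carrier premises, and products are normalised to right-nested form.\<close>

lemmas square_mult = assoc_mult_mat[where ?n\<^sub>1 = n and ?n\<^sub>2 = n and ?n\<^sub>3 = n and ?n\<^sub>4 = n]
  mult_carrier_mat[where nr = n and n = n and nc = n]
  minus_carrier_mat[where nr = n and nc = n]

lemmas square_distrib =
  add_mult_distrib_mat[where nr = n and n = n and nc = n]
  mult_add_distrib_mat[where nr = n and n = n and nc = n]
  minus_mult_distrib_mat[where nr = n and n = n and nc = n]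
  mult_minus_distrib_mat[where nr = n and n = n and nc = n]

lemma commutator_carrier:
  "X \<in> carrier_mat n n \<Longrightarrow> Y \<in> carrier_mat n n \<Longrightarrow> commutator X Y \<in> carrier_mat n n"
  by (simp add: commutator_def square_mult)

lemma ad2_carrier: "P \<in> carrier_mat n n \<Longrightarrow> X \<in> carrier_mat n n \<Longrightarrow> ad2 P X \<in> carrier_mat n n"
  by (simp add: ad2_def commutator_carrier)

lemma idem_mult_left:
  "P \<in> carrier_mat n n \<Longrightarrow> P * P = P \<Longrightarrow> Y \<in> carrier_mat n n \<Longrightarrow> P * (P * Y) = (P * Y :: complex mat)"
  by (metis assoc_mult_mat)

text \<open>The right-hand side is P X (1 - P) + (1 - P) X P, the off-diagonal part of
  \<open>X\<close> relative to range and kernel of \<open>P\<close>.\<close>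

lemma ad2_idem:
  assumes "P \<in> carrier_mat n n" "X \<in> carrier_mat n n" "P * P = P"
  shows "ad2 P X = P * X - P * (X * P) - (P * (X * P) - X * P)"
  using assms by (simp add: ad2_def commutator_def square_mult square_distrib idem_mult_left)

lemma ad2_mult_idem:
  assumes "P \<in> carrier_mat n n" "X \<in> carrier_mat n n" "P * P = P"
  shows "P * ad2 P X = P * X - P * (X * P)" "ad2 P X * P = X * P - P * (X * P)"
  \<comment> \<open>Equal products are cancelled entrywise; without \<open>index_mult_mat(1)\<close>
    an entry of a product stays an atom.\<close>
  using assms by (simp_all add: ad2_idem square_mult square_distrib idem_mult_left)
    (intro eq_matI; simp del: index_mult_mat(1))+

lemma ad2_tangent:
  assumes "P \<in> carrier_mat n n" "X \<in> carrier_mat n n" "P * P = P"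
  shows "P * ad2 P X + ad2 P X * P = ad2 P X"
  unfolding ad2_mult_idem[OF assms] using assms(1,2)
  by (subst ad2_idem[OF assms], intro eq_matI) (simp_all del: index_mult_mat(1))

text \<open>Multiplying the tangency equation by \<open>P\<close> on both sides gives PXP = 2 PXP,
  so the diagonal block on the range of \<open>P\<close> vanishes.\<close>

lemma tangent_compress:
  fixes P X :: "complex mat"
  assumes P: "P \<in> carrier_mat n n" and X: "X \<in> carrier_mat n n" and "P * P = P" "P * X + X * P = X"
  shows "P * (X * P) = 0\<^sub>m n n"
proof -
  have "P * (X * P) = P * ((P * X + X * P) * P)" by (simp add: assms)
  also have "\<dots> = P * (X * P) + P * (X * P)"
    using assms(1-3) by (simp add: square_mult square_distrib idem_mult_left)
  finally have *: "P * (X * P) = P * (X * P) + P * (X * P)" .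
  have c: "P * (X * P) \<in> carrier_mat n n" using P X by simp
  show ?thesis
  proof (rule eq_matI)
    fix i j assume ij: "i < dim_row (0\<^sub>m n n)" "j < dim_col (0\<^sub>m n n)"
    have "(P * (X * P)) $$ (i, j) = (P * (X * P) + P * (X * P)) $$ (i, j)" using * by simp
    also have "\<dots> = (P * (X * P)) $$ (i, j) + (P * (X * P)) $$ (i, j)"
      using ij c by (subst index_add_mat) auto
    finally show "(P * (X * P)) $$ (i, j) = 0\<^sub>m n n $$ (i, j)" using ij by simp
  qed (use c in auto)
qed

lemma ad2_tangent_fix:
  assumes P: "P \<in> carrier_mat n n" and X: "X \<in> carrier_mat n n" and "P * P = P" "P * X + X * P = X"
  shows "ad2 P X = X"
proof -
  have "ad2 P X = P * X + X * P"
    unfolding ad2_idem[OF assms(1-3)] tangent_compress[OF assms]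
    using P X by (intro eq_matI) (simp_all del: index_mult_mat(1))
  then show ?thesis using assms by simp
qed

text \<open>Cyclicity of the trace: after expansion of both sides only tr(PYX) and tr(PYPX) have to
  be rotated, the term tr(YPX) being common.\<close>

lemma mtrace_ad2_adjoint:
  assumes P: "P \<in> carrier_mat n n" and X: "X \<in> carrier_mat n n" and Y: "Y \<in> carrier_mat n n"
    and PP: "P * P = P"
  shows "mtrace (ad2 P Y * X) = mtrace (Y * ad2 P X)"
proof -
  have "mtrace (P * (Y * X)) = mtrace (Y * (X * P))"
    using P X Y by (subst mtrace_mult_commute[of _ n n]) (simp_all add: square_mult)
  moreover have "mtrace (P * (Y * (P * X))) = mtrace (Y * (P * (X * P)))"
    using P X Y by (subst mtrace_mult_commute[of _ n n]) (simp_all add: square_mult)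
  ultimately show ?thesis
    using P X Y PP
    by (simp add: ad2_idem square_mult square_distrib idem_mult_left mtrace_minus[of _ n])
qed

lemma ad2_eq_0_iff:
  assumes P: "P \<in> carrier_mat n n" and X: "X \<in> carrier_mat n n" and PP: "P * P = P"
  shows "ad2 P X = 0\<^sub>m n n \<longleftrightarrow> commutator P X = 0\<^sub>m n n"
proof
  assume 0: "ad2 P X = 0\<^sub>m n n"
  have "commutator P X = P * ad2 P X - ad2 P X * P"
    unfolding commutator_def ad2_mult_idem[OF assms] using P X by (intro eq_matI) (simp_all del: index_mult_mat(1))
  also have "\<dots> = 0\<^sub>m n n" using P by (simp add: 0)
  finally show "commutator P X = 0\<^sub>m n n" .
next
  assume "commutator P X = 0\<^sub>m n n"
  then show "ad2 P X = 0\<^sub>m n n" using P by (simp add: ad2_def) (simp add: commutator_def)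
qed

lemma ad2_her:
  assumes "P \<in> her n" "X \<in> her n" "P * P = P"
  shows "ad2 P X \<in> her n"
proof -
  note c = her_carrier[OF assms(1)] her_carrier[OF assms(2)]
  have "mat_adjoint P = P" "mat_adjoint X = X" using assms by (auto simp: her_def)
  then have "mat_adjoint (ad2 P X) = X * P - P * (X * P) - (P * (X * P) - P * X)"
    using c assms(3)
    by (simp add: ad2_idem mat_adjoint_minus[of _ n n] mat_adjoint_mult[of _ n n _ n] square_mult)
  also have "\<dots> = ad2 P X"
    unfolding ad2_idem[OF c assms(3)] using c by (intro eq_matI) (simp_all del: index_mult_mat(1))
  finally show ?thesis using c by (simp add: her_def ad2_carrier)
qed

end

text \<open>In right-nested form \<open>A * B\<close> is no subterm of \<open>A * (B * Z)\<close>,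
  so a commutation identity must carry a trailing factor before it can rewrite.\<close>

lemma mult_left_cong:
  assumes "A * B = C * D" "A \<in> carrier_mat n n" "B \<in> carrier_mat n n"
    "C \<in> carrier_mat n n" "D \<in> carrier_mat n n" "Z \<in> carrier_mat n n"
  shows "A * (B * Z) = C * (D * (Z :: complex mat))"
  using assms(1) assoc_mult_mat[OF assms(2,3,6)] assoc_mult_mat[OF assms(4,5,6)] by metis

section \<open>Curves in the Grassmannian\<close>

text \<open>The retraction below is the orthogonal projector onto the column space of \<open>M = P + X P\<close>,
  that is \<open>M (M\<^sup>\<dagger> M)\<^sup>-\<^sup>1 M\<^sup>\<dagger>\<close>; here \<open>M\<^sup>\<dagger> M = P (1 + X\<^sup>2)\<close>.\<close>

lemma Gr_retraction:
  assumes P: "P \<in> Gr m n" and X: "X \<in> her n" and T: "P * X + X * P = X"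
    and S: "S \<in> carrier_mat n n"
    and SR: "S * (1\<^sub>m n + X * X) = 1\<^sub>m n" and RS: "(1\<^sub>m n + X * X) * S = 1\<^sub>m n"
  shows "S * (P + X + X * (P * X)) \<in> Gr m n"
proof -
  define R where "R = 1\<^sub>m n + X * X"
  \<comment> \<open>M = (1 + X) P, and \<open>N\<close> = P (1 + X) turns out to be its adjoint, as
    \<open>P\<close> and \<open>X\<close> are Hermitian.\<close>
  define M where "M = P + X * P"
  define N where "N = P + P * X"
  have c: "P \<in> carrier_mat n n" "X \<in> carrier_mat n n" "S \<in> carrier_mat n n" "R \<in> carrier_mat n n"
    "M \<in> carrier_mat n n" "N \<in> carrier_mat n n"
    using P X S by (auto simp: R_def M_def N_def Gr_def her_def)
  have PP: "P * P = P" and Ph: "mat_adjoint P = P" and trP: "mtrace P = of_nat m"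
    and Xh: "mat_adjoint X = X"
    using P X by (auto simp: Gr_def her_def)
  note mult = square_mult[where n = n] and distrib = square_distrib[where n = n]
  note PXP = tangent_compress[OF c(1,2) PP T]
  have PXPX: "P * (X * (P * X)) = 0\<^sub>m n n"
  proof -
    have "P * (X * (P * X)) = P * (X * P) * X" using c by (simp add: mult)
    then show ?thesis using c by (simp add: PXP del: assoc_mult_mat)
  qed
  \<comment> \<open>A tangent \<open>X\<close> maps the range of \<open>P\<close> into the kernel
    and the kernel into the range, so its square preserves both and commutes with
    \<open>P\<close>.\<close>
  have PXX: "X * (X * P) = P * (X * X)"
  proof -
    have "P * (X * X) = P * (X * (P * X + X * P))" by (simp add: T)
    also have "\<dots> = P * (X * (X * P))" using c by (simp add: mult distrib PXPX)
    also have "\<dots> = (P * X + X * P) * (X * P)" using c by (simp add: mult distrib PXP)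
    finally show ?thesis using c by (simp add: T mult)
  qed
  have RP: "R * P = P * R" and RX: "R * X = X * R"
    using c by (simp_all add: R_def mult distrib PXX)
  \<comment> \<open>The inverse \<open>S\<close> of \<open>R\<close> commutes with everything that
    \<open>R\<close> commutes with.\<close>
  have comm: "S * Z = Z * S" if Z: "Z \<in> carrier_mat n n" and "R * Z = Z * R" for Z
  proof -
    have "S * Z = S * (Z * R) * S" using c Z RS by (simp add: mult R_def[symmetric])
    also have "\<dots> = (S * R) * Z * S" using c Z by (simp add: mult that(2)[symmetric])
    also have "\<dots> = Z * S" using c Z SR by (simp add: R_def[symmetric])
    finally show ?thesis .
  qed
  have "M * N = P + (P * X + X * P) + X * (P * X)"
    using c
    by (simp add: M_def N_def mult distrib PP idem_mult_left)
      (intro eq_matI; simp del: index_mult_mat(1))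
  then have MN: "M * N = P + X + X * (P * X)" by (simp only: T)
  have NM: "N * M = R * P"
    using c by (simp add: M_def N_def R_def mult distrib PP idem_mult_left PXP PXX)
  have PN: "P * N = N" using c PP by (simp add: N_def mult distrib idem_mult_left)
  have RPZ: "R * (P * Z) = P * (R * Z)" and RXZ: "R * (X * Z) = X * (R * Z)"
    if "Z \<in> carrier_mat n n" for Z
    using mult_left_cong[OF RP] mult_left_cong[OF RX] c that by blast+
  have RM: "R * M = M * R" and RN: "R * N = N * R"
    using c RPZ RXZ RP RX by (simp_all add: M_def N_def mult distrib)
  then have SN: "S * N = N * S" and SM: "S * M = M * S"
    using comm c by auto
  \<comment> \<open>These rules carry \<open>S\<close> and \<open>R\<close> leftwards past
    \<open>M\<close> and \<open>N\<close>, where they meet and cancel; the last one is N M = R P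
    with a trailing factor.\<close>
  have push: "N * (S * Z) = S * (N * Z)" "M * (S * Z) = S * (M * Z)" "M * (R * Z) = R * (M * Z)"
    "N * (M * Z) = R * (P * Z)" if "Z \<in> carrier_mat n n" for Z
    using mult_left_cong[OF SN] mult_left_cong[OF SM] mult_left_cong[OF RM] mult_left_cong[OF NM] c that
    by auto
  \<comment> \<open>Taking adjoints in R S = 1 makes the adjoint of \<open>S\<close> a left inverse
    of the Hermitian \<open>R\<close>, hence equal to \<open>S\<close>.\<close>
  have Sh: "mat_adjoint S = S"
  proof -
    have "mat_adjoint R = R"
      using c Xh by (simp add: R_def mat_adjoint_add[of _ n n] mat_adjoint_mult[of _ n n _ n] mat_adjoint_one)
    then have "mat_adjoint S * R = 1\<^sub>m n"
      using RS c by (metis R_def mat_adjoint_mult mat_adjoint_one)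
    then have "mat_adjoint S * (R * S) = S"
      using c assoc_mult_mat[OF mat_adjoint_carrier[OF c(3)] c(4) c(3)] by (simp del: assoc_mult_mat)
    then show ?thesis using RS right_mult_one_mat[OF mat_adjoint_carrier[OF c(3)]] by (simp add: R_def)
  qed
  have G: "S * (P + X + X * (P * X)) = S * (M * N)" by (simp add: MN)
  have "mat_adjoint N = M" using c Ph Xh
    by (simp add: M_def N_def mat_adjoint_add[of _ n n] mat_adjoint_mult[of _ n n _ n])
  moreover have "mat_adjoint M = N" using c Ph Xh
    by (simp add: M_def N_def mat_adjoint_add[of _ n n] mat_adjoint_mult[of _ n n _ n])
  ultimately have "mat_adjoint (S * (M * N)) = M * N * S"
    using c Sh by (simp add: mat_adjoint_mult[of _ n n _ n])
  also have "\<dots> = S * (M * N)"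
    using c by (simp add: mult push SN[symmetric])
  finally have adj: "mat_adjoint (S * (M * N)) = S * (M * N)" .
  have SRY: "S * (R * Y) = Y" if "Y \<in> carrier_mat n n" for Y
    using SR assoc_mult_mat[OF c(3,4) that] that by (simp add: R_def del: assoc_mult_mat)
  have idem: "S * (M * N) * (S * (M * N)) = S * (M * N)"
    using c by (simp add: mult push PN SRY)
  \<comment> \<open>Cyclicity turns S M N into N S M = S R P = P, so the rank \<open>m\<close> is
    kept.\<close>
  have "mtrace (S * (M * N)) = mtrace (S * M * N)" using c by (simp add: mult)
  also have "\<dots> = mtrace (N * (S * M))"
    using c by (intro mtrace_mult_commute) auto
  also have "N * (S * M) = P"
    using c by (simp add: push NM SRY)
  finally have tr: "mtrace (S * (M * N)) = of_nat m" by (simp add: trP)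
  show ?thesis unfolding G using c adj idem tr by (simp add: Gr_def)
qed

text \<open>The complex quotient rule, restricted to real arguments, gives an explicit derivative
  that is again a quotient of polynomials with nonvanishing denominator, hence continuous.\<close>

lemma rational_C1_differentiable_on:
  fixes p q :: "complex poly"
  assumes "\<And>t. t \<in> S \<Longrightarrow> poly q (of_real t) \<noteq> 0"
  shows "(\<lambda>t. poly p (of_real t) / poly q (of_real t)) C1_differentiable_on S"
  unfolding C1_differentiable_on_def
proof (intro exI conjI ballI)
  fix t assume "t \<in> S"
  then have "((\<lambda>z. poly p z / poly q z) has_field_derivative
      (poly (pderiv p) (of_real t) * poly q (of_real t) - poly p (of_real t) * poly (pderiv q) (of_real t))
        / (poly q (of_real t) * poly q (of_real t))) (at (of_real t))"
    using assms by (intro DERIV_divide poly_DERIV) auto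
  then show "((\<lambda>t. poly p (of_real t) / poly q (of_real t)) has_vector_derivative
      (poly (pderiv p) (of_real t) * poly q (of_real t) - poly p (of_real t) * poly (pderiv q) (of_real t))
        / (poly q (of_real t) * poly q (of_real t))) (at t)"
    by (rule has_vector_derivative_real_field)
qed (use assms in \<open>auto intro!: continuous_intros\<close>)

text \<open>The retraction is applied to tX for small t. This is the half of the description of
  tangent vectors that shows the candidate gradient to be tangent.\<close>

lemma Gr_curve:
  assumes P: "P \<in> Gr m n" and X: "X \<in> her n" and T: "P * X + X * P = X"
  obtains \<epsilon> \<gamma> where "\<epsilon> > 0" "\<And>t. t \<in> {-\<epsilon><..<\<epsilon>} \<Longrightarrow> \<gamma> t \<in> Gr m n"
    "\<And>a b. a < n \<Longrightarrow> b < n \<Longrightarrow> (\<lambda>t. \<gamma> t $$ (a, b)) C1_differentiable_on {-\<epsilon><..<\<epsilon>}"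
    "\<gamma> 0 = P"
    "\<And>a b. a < n \<Longrightarrow> b < n \<Longrightarrow> ((\<lambda>t. \<gamma> t $$ (a, b)) has_vector_derivative X $$ (a, b)) (at 0)"
proof -
  have c: "P \<in> carrier_mat n n" "X \<in> carrier_mat n n"
    using P X by (auto simp: Gr_def her_def)
  \<comment> \<open>Matrices over the polynomials in t: \<open>Q\<close> encodes 1 + t^2 X^2 and
    \<open>K\<close> encodes P + tX + t^2 XPX. Where det Q does not vanish, the adjugate
    \<open>D\<close> divided by det Q inverts \<open>Q\<close>.\<close>
  define Q where "Q = mat n n (\<lambda>ij. [:1\<^sub>m n $$ ij, 0, (X * X) $$ ij:])"
  define K where "K = mat n n (\<lambda>ij. [:P $$ ij, X $$ ij, (X * (P * X)) $$ ij:])"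
  define D where "D = adj_mat Q"
  define ev :: "real \<Rightarrow> complex poly \<Rightarrow> complex" where "ev t p = poly p (of_real t)" for t p
  define d where "d t = ev t (det Q)" for t
  define \<gamma> where "\<gamma> t = mat n n (\<lambda>ij. ev t ((D * K) $$ ij) / d t)" for t
  \<comment> \<open>Evaluation at t is a ring homomorphism, so determinants and products of
    polynomial matrices specialise to each t.\<close>
  interpret ev: comm_ring_hom "ev t" for t
    by unfold_locales (auto simp: ev_def)
  have cQ: "Q \<in> carrier_mat n n" and cK: "K \<in> carrier_mat n n" and cD: "D \<in> carrier_mat n n"
    using adj_mat(1)[of Q n] by (auto simp: Q_def K_def D_def)
  have evQ: "map_mat (ev t) Q = 1\<^sub>m n + (of_real t \<cdot>\<^sub>m X) * (of_real t \<cdot>\<^sub>m X)" for t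
    using c by (intro eq_matI)
      (auto simp: Q_def ev_def
        mult_smult_distrib[of _ n n _ n] mult_smult_assoc_mat[of _ n n _ n]
        simp del: index_mult_mat(1))
  have evK: "map_mat (ev t) K = P + of_real t \<cdot>\<^sub>m X + (of_real t \<cdot>\<^sub>m X) * (P * (of_real t \<cdot>\<^sub>m X))" for t
    using c by (intro eq_matI)
      (auto simp: K_def ev_def algebra_simps
        mult_smult_distrib[of _ n n _ n] mult_smult_assoc_mat[of _ n n _ n]
        simp del: index_mult_mat(1))
  have \<gamma>: "\<gamma> t = (inverse (d t) \<cdot>\<^sub>m map_mat (ev t) D) * map_mat (ev t) K" for t
    using cD cK
    by (intro eq_matI)
      (auto simp: \<gamma>_def ev.mat_hom_mult[OF cD cK, symmetric]
        mult_smult_assoc_mat[of _ n n _ n] divide_inverse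
        simp del: index_mult_mat(1))
  have inv: "(inverse (d t) \<cdot>\<^sub>m map_mat (ev t) D) * map_mat (ev t) Q = 1\<^sub>m n"
      "map_mat (ev t) Q * (inverse (d t) \<cdot>\<^sub>m map_mat (ev t) D) = 1\<^sub>m n" if "d t \<noteq> 0" for t
  proof -
    have "map_mat (ev t) (det Q \<cdot>\<^sub>m 1\<^sub>m n) = d t \<cdot>\<^sub>m 1\<^sub>m n"
      by (intro eq_matI) (auto simp: d_def)
    then have "map_mat (ev t) D * map_mat (ev t) Q = d t \<cdot>\<^sub>m 1\<^sub>m n"
      "map_mat (ev t) Q * map_mat (ev t) D = d t \<cdot>\<^sub>m 1\<^sub>m n"
      unfolding D_def using ev.mat_hom_mult[OF cD[unfolded D_def] cQ] ev.mat_hom_mult[OF cQ cD[unfolded D_def]]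
      by (simp_all add: adj_mat[OF cQ])
    then show "(inverse (d t) \<cdot>\<^sub>m map_mat (ev t) D) * map_mat (ev t) Q = 1\<^sub>m n"
      "map_mat (ev t) Q * (inverse (d t) \<cdot>\<^sub>m map_mat (ev t) D) = 1\<^sub>m n"
      using cQ cD that by
        (auto simp: mult_smult_distrib[of _ n n _ n] mult_smult_assoc_mat[of _ n n _ n]
          intro!: eq_matI simp del: index_mult_mat(1))
  qed
  have "d 0 = 1"
  proof -
    have "d 0 = det (map_mat (ev 0) Q)" by (simp add: d_def)
    also have "map_mat (ev 0) Q = 1\<^sub>m n" using cQ by (intro eq_matI) (auto simp: Q_def ev_def)
    finally show ?thesis by simp
  qed
  \<comment> \<open>The determinant is 1 at t = 0, so it stays nonzero on an interval around 0; this
    interval is the domain of the curve.\<close>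
  have "continuous_on UNIV d" unfolding d_def ev_def by (intro continuous_intros)
  then have "open {t. d t \<noteq> 0}" by (intro open_Collect_neq continuous_on_const)
  moreover have "0 \<in> {t. d t \<noteq> 0}" using \<open>d 0 = 1\<close> by simp
  ultimately obtain \<epsilon> where \<epsilon>: "\<epsilon> > 0" "ball 0 \<epsilon> \<subseteq> {t. d t \<noteq> 0}"
    using open_contains_ball by blast
  then have nz: "d t \<noteq> 0" if "t \<in> {-\<epsilon><..<\<epsilon>}" for t
    using that by (auto simp: subset_iff dist_real_def)
  have "\<gamma> t \<in> Gr m n" if "t \<in> {-\<epsilon><..<\<epsilon>}" for t
  proof -
    let ?X = "of_real t \<cdot>\<^sub>m X"
    have "?X \<in> her n"
      unfolding her_iff
    proof (intro conjI allI impI)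
      fix i j assume "i < n" "j < n"
      then show "?X $$ (j, i) = cnj (?X $$ (i, j))"
        using c her_index[OF X, of i j] by simp
    qed (use c in simp)
    moreover have "P * ?X + ?X * P = ?X"
    proof -
      have "P * ?X + ?X * P = of_real t \<cdot>\<^sub>m (P * X + X * P)"
        using c by (simp add: mult_smult_distrib[of _ n n _ n] mult_smult_assoc_mat[of _ n n _ n] add_smult_distrib_left_mat[of _ n n])
      then show ?thesis by (simp add: T)
    qed
    ultimately show ?thesis
      unfolding \<gamma> evK using inv[OF nz[OF that]] cD
      by (intro Gr_retraction[OF P]) (auto simp: evQ)
  qed
  moreover have C1: "(\<lambda>t. \<gamma> t $$ (a, b)) C1_differentiable_on {-\<epsilon><..<\<epsilon>}" if "a < n" "b < n" for a b
    using that nz rational_C1_differentiable_on[of "{-\<epsilon><..<\<epsilon>}" "det Q" "(D * K) $$ (a, b)"]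
    by (simp add: \<gamma>_def ev_def d_def)
  moreover have "\<gamma> 0 = P"
  proof -
    have "map_mat (ev 0) Q = 1\<^sub>m n" "map_mat (ev 0) K = P"
      using c by (auto simp: Q_def K_def ev_def intro!: eq_matI)
    then show ?thesis
      using \<open>d 0 = 1\<close> inv(1)[of 0] cD c unfolding \<gamma>
      by (simp add: right_mult_one_mat[of _ n n])
  qed
  moreover have "((\<lambda>t. \<gamma> t $$ (a, b)) has_vector_derivative X $$ (a, b)) (at 0)"
    if ab: "a < n" "b < n" for a b
  proof -
    \<comment> \<open>The identity (1 + t^2 X^2) \<gamma>(t) = P + tX + t^2 XPX is solved for the
      leading \<gamma>(t), with remainder t^2 times \<open>?h\<close>. Since \<open>?h\<close> is
      differentiable at 0, the remainder has derivative 0 there and the velocity \<open>X\<close> is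
      read off without differentiating an inverse.\<close>
    let ?h = "\<lambda>t. (X * (P * X)) $$ (a, b) - (\<Sum>k<n. (X * X) $$ (a, k) * \<gamma> t $$ (k, b))"
    have "\<gamma> t $$ (a, b) = P $$ (a, b) + of_real t * X $$ (a, b) + of_real (t\<^sup>2) * ?h t"
      if "t \<in> {-\<epsilon><..<\<epsilon>}" for t
    proof -
      have c\<gamma>: "\<gamma> t \<in> carrier_mat n n" by (simp add: \<gamma>_def)
      have cS: "inverse (d t) \<cdot>\<^sub>m map_mat (ev t) D \<in> carrier_mat n n" using cD by simp
      have "map_mat (ev t) Q * \<gamma> t = map_mat (ev t) K"
        unfolding \<gamma> using cQ cK
        by (subst assoc_mult_mat[symmetric, OF _ cS, of _ n _ n]) (simp_all add: inv[OF nz[OF that]])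
      moreover have "map_mat (ev t) Q = 1\<^sub>m n + of_real (t\<^sup>2) \<cdot>\<^sub>m (X * X)"
        using c by (intro eq_matI) (auto simp: Q_def ev_def power2_eq_square simp del: index_mult_mat(1))
      ultimately have "\<gamma> t + of_real (t\<^sup>2) \<cdot>\<^sub>m (X * X * \<gamma> t) = map_mat (ev t) K"
        using c c\<gamma>
        by (simp add: add_mult_distrib_mat[of _ n n _ _ n] mult_smult_assoc_mat[of _ n n _ n] del: assoc_mult_mat)
      then have "(\<gamma> t + of_real (t\<^sup>2) \<cdot>\<^sub>m (X * X * \<gamma> t)) $$ (a, b) = map_mat (ev t) K $$ (a, b)"
        by simp
      then have "\<gamma> t $$ (a, b) + of_real (t\<^sup>2) * (X * X * \<gamma> t) $$ (a, b)
          = P $$ (a, b) + of_real t * X $$ (a, b) + of_real (t\<^sup>2) * (X * (P * X)) $$ (a, b)"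
        using ab c c\<gamma>
        by (simp add: K_def ev_def power2_eq_square algebra_simps del: index_mult_mat(1) assoc_mult_mat)
      moreover have "(X * X * \<gamma> t) $$ (a, b) = (\<Sum>k<n. (X * X) $$ (a, k) * \<gamma> t $$ (k, b))"
        using ab c c\<gamma> by (intro mat_mult_index) auto
      ultimately show ?thesis by (simp add: algebra_simps)
    qed
    moreover have "\<exists>h'. (?h has_vector_derivative h') (at 0)"
    proof -
      have "\<exists>g. ((\<lambda>t. \<gamma> t $$ (k, b)) has_vector_derivative g) (at 0)" if "k < n" for k
        using C1[OF that ab(2)] \<epsilon>(1) unfolding C1_differentiable_on_def by fastforce
      then obtain g where "\<And>k. k < n \<Longrightarrow> ((\<lambda>t. \<gamma> t $$ (k, b)) has_vector_derivative g k) (at 0)"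
        by metis
      then have "(?h has_vector_derivative 0 - (\<Sum>k<n. (X * X) $$ (a, k) * g k)) (at 0)"
        by (intro has_vector_derivative_diff has_vector_derivative_const has_vector_derivative_sum
          has_vector_derivative_mult_right) auto
      then show ?thesis ..
    qed
    then obtain h' where h': "(?h has_vector_derivative h') (at 0)" ..
    have "((\<lambda>t. P $$ (a, b) + of_real t * X $$ (a, b) + of_real (t\<^sup>2) * ?h t)
        has_vector_derivative 0 + (of_real 0 * 0 + of_real 1 * X $$ (a, b))
          + (of_real (0\<^sup>2) * h' + of_real 0 * ?h 0)) (at 0)"
      by (intro has_vector_derivative_add has_vector_derivative_mult has_vector_derivative_const
          has_vector_derivative_of_real h') (auto intro!: derivative_eq_intros)
    then have "((\<lambda>t. P $$ (a, b) + of_real t * X $$ (a, b) + of_real (t\<^sup>2) * ?h t)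
        has_vector_derivative X $$ (a, b)) (at 0)"
      by simp
    ultimately show ?thesis
      using \<epsilon>(1) by (elim has_vector_derivative_transform_within_open[where S = "{-\<epsilon><..<\<epsilon>}"]) auto
  qed
  ultimately show thesis using \<epsilon>(1) that by blast
qed

lemma curve_velocity_tangent:
  assumes \<gamma>: "curve_with_velocity r n (Gr_prod r m n) P \<xi> \<gamma>"
    and \<xi>: "\<xi> ! j \<in> carrier_mat (n j) (n j)" and P: "P ! j \<in> carrier_mat (n j) (n j)" and j: "j < r"
  shows "P ! j * \<xi> ! j + \<xi> ! j * P ! j = \<xi> ! j"
proof (rule eq_matI)
  fix a b assume "a < dim_row (\<xi> ! j)" "b < dim_col (\<xi> ! j)"
  then have ab: "a < n j" "b < n j" using \<xi> by auto
  obtain \<epsilon> where \<epsilon>: "\<epsilon> > 0" "\<And>t. t \<in> {-\<epsilon><..<\<epsilon>} \<Longrightarrow> \<gamma> t \<in> Gr_prod r m n"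
    using \<gamma> unfolding curve_with_velocity_def by blast
  have \<gamma>0: "\<gamma> 0 = P"
    and d: "\<And>a b. a < n j \<Longrightarrow> b < n j \<Longrightarrow> ((\<lambda>t. (\<gamma> t ! j) $$ (a, b)) has_vector_derivative (\<xi> ! j) $$ (a, b)) (at 0)"
    using \<gamma> j unfolding curve_with_velocity_def by auto
  have "(\<Sum>k<n j. (\<gamma> t ! j) $$ (a, k) * (\<gamma> t ! j) $$ (k, b)) = (\<gamma> t ! j) $$ (a, b)"
    if "t \<in> {-\<epsilon><..<\<epsilon>}" for t
  proof -
    have "\<gamma> t ! j \<in> Gr (m j) (n j)" using \<epsilon>(2)[OF that] j by (simp add: Gr_prod_def)
    then have c: "\<gamma> t ! j \<in> carrier_mat (n j) (n j)" and "\<gamma> t ! j * \<gamma> t ! j = \<gamma> t ! j"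
      by (auto simp: Gr_def)
    then have "(\<gamma> t ! j) $$ (a, b) = (\<gamma> t ! j * \<gamma> t ! j) $$ (a, b)" by simp
    also have "\<dots> = (\<Sum>k<n j. (\<gamma> t ! j) $$ (a, k) * (\<gamma> t ! j) $$ (k, b))"
      using c ab by (subst index_mult_mat) (auto simp: scalar_prod_def lessThan_atLeast0)
    finally show ?thesis by simp
  qed
  moreover have "((\<lambda>t. \<Sum>k<n j. (\<gamma> t ! j) $$ (a, k) * (\<gamma> t ! j) $$ (k, b)) has_vector_derivative
      (\<Sum>k<n j. (\<gamma> 0 ! j) $$ (a, k) * (\<xi> ! j) $$ (k, b) + (\<xi> ! j) $$ (a, k) * (\<gamma> 0 ! j) $$ (k, b))) (at 0)"
    using ab d by (intro has_vector_derivative_sum has_vector_derivative_mult) auto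
  \<comment> \<open>The curve is known to consist of projectors only near 0, so the derivative of
    the square is transferred on that interval; comparison with the given velocity yields the
    equation.\<close>
  ultimately have "((\<lambda>t. (\<gamma> t ! j) $$ (a, b)) has_vector_derivative
      (\<Sum>k<n j. (\<gamma> 0 ! j) $$ (a, k) * (\<xi> ! j) $$ (k, b) + (\<xi> ! j) $$ (a, k) * (\<gamma> 0 ! j) $$ (k, b))) (at 0)"
    using \<epsilon>(1) by (elim has_vector_derivative_transform_within_open[where S = "{-\<epsilon><..<\<epsilon>}"]) auto
  from vector_derivative_unique_at[OF this d[OF ab]]
  show "(P ! j * \<xi> ! j + \<xi> ! j * P ! j) $$ (a, b) = (\<xi> ! j) $$ (a, b)"
    using ab \<xi> P by (simp add: \<gamma>0 scalar_prod_def lessThan_atLeast0 sum.distrib)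
qed (use \<xi> P in auto)

section \<open>Kronecker products as multilinear maps\<close>

lemma kron_index:
  assumes "a < dim_row A * dim_row B" "b < dim_col A * dim_col B"
  shows "kron A B $$ (a, b)
    = A $$ (a div dim_row B, b div dim_col B) * B $$ (a mod dim_row B, b mod dim_col B)"
  using assms by (simp add: kron_def)

lemma kron_list_carrier:
  "(\<And>j. j < length Ps \<Longrightarrow> Ps ! j \<in> carrier_mat (n j) (n j)) \<Longrightarrow>
    kron_list Ps \<in> carrier_mat (\<Prod>j<length Ps. n j) (\<Prod>j<length Ps. n j)"
proof (induction Ps arbitrary: n)
  case (Cons P Ps)
  have "kron_list Ps \<in> carrier_mat (\<Prod>j<length Ps. n (Suc j)) (\<Prod>j<length Ps. n (Suc j))"
    using Cons.prems by (intro Cons.IH) fastforce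
  moreover have "P \<in> carrier_mat (n 0) (n 0)" using Cons.prems[of 0] by simp
  ultimately show ?case
    by (simp add: kron_def prod.lessThan_Suc_shift del: prod.lessThan_Suc)
qed simp

lemma kron_list_update_carrier:
  assumes "\<And>i. i < length Ps \<Longrightarrow> Ps ! i \<in> carrier_mat (n i) (n i)" "Z \<in> carrier_mat (n j) (n j)"
  shows "kron_list (Ps[j := Z]) \<in> carrier_mat (\<Prod>i<length Ps. n i) (\<Prod>i<length Ps. n i)"
proof -
  have "Ps[j := Z] ! i \<in> carrier_mat (n i) (n i)" if "i < length Ps" for i
    using assms that by (cases "i = j") auto
  then show ?thesis using kron_list_carrier[of "Ps[j := Z]" n] by simp
qed

text \<open>Splits an index of a Kronecker product into block number and position inside a block of
  size \<open>N\<close>; the bound itself forces \<open>N\<close> to be positive.\<close>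

lemma div_mod_less_mult:
  fixes a k N :: nat
  assumes "a < k * N"
  shows "a div N < k" "a mod N < N"
  using assms by (auto simp: less_mult_imp_div_less intro!: mod_less_divisor gr0I)

text \<open>Leibniz rule. An entry of a Kronecker product is one entry of the first factor times one
  entry of the rest, so induction only needs the scalar product rule.\<close>

lemma kron_list_has_vector_derivative:
  fixes G :: "nat \<Rightarrow> real \<Rightarrow> complex mat"
  assumes "\<And>j t. j < r \<Longrightarrow> G j t \<in> carrier_mat (n j) (n j)"
    and "\<And>j. j < r \<Longrightarrow> X j \<in> carrier_mat (n j) (n j)"
    and "\<And>j a b. j < r \<Longrightarrow> a < n j \<Longrightarrow> b < n j \<Longrightarrow>
      ((\<lambda>t. G j t $$ (a, b)) has_vector_derivative X j $$ (a, b)) (at s)"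
    and "a < (\<Prod>j<r. n j)" "b < (\<Prod>j<r. n j)"
  shows "((\<lambda>t. kron_list (map (\<lambda>j. G j t) [0..<r]) $$ (a, b)) has_vector_derivative
    (\<Sum>j<r. kron_list ((map (\<lambda>j. G j s) [0..<r])[j := X j]) $$ (a, b))) (at s)"
  using assms
proof (induction r arbitrary: G X n a b)
  case (Suc r)
  define N where "N = (\<Prod>j<r. n (Suc j))"
  define H where "H t = kron_list (map (\<lambda>j. G (Suc j) t) [0..<r])" for t
  define H' where "H' j = kron_list ((map (\<lambda>j. G (Suc j) s) [0..<r])[j := X (Suc j)])" for j
  \<comment> \<open>\<open>kron_list\<close> nests to the right, so the induction strips index 0 and
    shifts the others; \<open>N\<close> is the size of what remains.\<close>
  have prod: "(\<Prod>j<Suc r. n j) = n 0 * N" unfolding N_def by (rule prod.lessThan_Suc_shift)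
  have ab: "a div N < n 0" "b div N < n 0" "a mod N < N" "b mod N < N"
    using Suc.prems(4,5) unfolding prod by (auto dest: div_mod_less_mult)
  have H: "H t \<in> carrier_mat N N" for t
    unfolding H_def N_def using kron_list_carrier[of "map (\<lambda>j. G (Suc j) t) [0..<r]" "\<lambda>j. n (Suc j)"] Suc.prems(1)
    by simp
  have H': "H' j \<in> carrier_mat N N" if "j < r" for j
    unfolding H'_def N_def using kron_list_carrier[of "(map (\<lambda>j. G (Suc j) s) [0..<r])[j := X (Suc j)]" "\<lambda>j. n (Suc j)"]
      Suc.prems(1,2) that by (auto simp: nth_list_update)
  have G0: "G 0 t \<in> carrier_mat (n 0) (n 0)" and X0: "X 0 \<in> carrier_mat (n 0) (n 0)" for t
    using Suc.prems(1,2) by auto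
  have split: "kron A B $$ (a, b) = A $$ (a div N, b div N) * B $$ (a mod N, b mod N)"
    if "A \<in> carrier_mat (n 0) (n 0)" "B \<in> carrier_mat N N" for A B
    using kron_index[of a A B b] that Suc.prems(4,5) unfolding prod by auto
  have IH: "((\<lambda>t. H t $$ (a mod N, b mod N)) has_vector_derivative
      (\<Sum>j<r. H' j $$ (a mod N, b mod N))) (at s)"
    unfolding H_def H'_def
    by (rule Suc.IH[where n = "\<lambda>j. n (Suc j)"]) (use Suc.prems ab in \<open>auto simp: N_def\<close>)
  have "((\<lambda>t. G 0 t $$ (a div N, b div N) * H t $$ (a mod N, b mod N)) has_vector_derivative
      G 0 s $$ (a div N, b div N) * (\<Sum>j<r. H' j $$ (a mod N, b mod N))
        + X 0 $$ (a div N, b div N) * H s $$ (a mod N, b mod N)) (at s)"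
    using Suc.prems(3) ab IH by (intro has_vector_derivative_mult) auto
  moreover have "kron_list (map (\<lambda>j. G j t) [0..<Suc r]) $$ (a, b)
      = G 0 t $$ (a div N, b div N) * H t $$ (a mod N, b mod N)" for t
    by (simp only: map_upt_Suc kron_list.simps split[OF G0 H] H_def[symmetric])
  \<comment> \<open>The summand j = 0 replaces the first factor, the later ones replace a factor of
    the remaining product.\<close>
  moreover have "(\<Sum>j<Suc r. kron_list ((map (\<lambda>j. G j s) [0..<Suc r])[j := X j]) $$ (a, b))
      = G 0 s $$ (a div N, b div N) * (\<Sum>j<r. H' j $$ (a mod N, b mod N))
        + X 0 $$ (a div N, b div N) * H s $$ (a mod N, b mod N)"
    by (simp add: sum.lessThan_Suc_shift map_upt_Suc split[OF G0 H'] split[OF X0 H] H_def[symmetric]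
        H'_def[symmetric] sum_distrib_left del: upt_Suc sum.lessThan_Suc)
  ultimately show ?case by simp
qed (simp add: has_vector_derivative_const)

text \<open>Linearity in the factor \<open>j\<close> in its most concrete form: \<open>c\<close>,
  \<open>u\<close> and \<open>v\<close> depend on the position (a, b) and on the other factors but
  not on \<open>Z\<close>. This makes the trace a weighted sum of entries of
  \<open>Z\<close>.\<close>

lemma kron_list_update_index:
  assumes "\<And>i. i < length Ps \<Longrightarrow> Ps ! i \<in> carrier_mat (n i) (n i)" "j < length Ps"
    and "a < (\<Prod>i<length Ps. n i)" "b < (\<Prod>i<length Ps. n i)"
  shows "\<exists>c u v. u < n j \<and> v < n j \<and>
    (\<forall>Z \<in> carrier_mat (n j) (n j). kron_list (Ps[j := Z]) $$ (a, b) = c * Z $$ (u, v))"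
  using assms
proof (induction Ps arbitrary: n j a b)
  case (Cons P Ps)
  define N where "N = (\<Prod>i<length Ps. n (Suc i))"
  have prod: "(\<Prod>i<length (P # Ps). n i) = n 0 * N"
    unfolding N_def list.size(4) by (simp add: prod.lessThan_Suc_shift del: prod.lessThan_Suc)
  have ab: "a div N < n 0" "b div N < n 0" "a mod N < N" "b mod N < N"
    using Cons.prems(3,4) unfolding prod by (auto dest: div_mod_less_mult)
  have P: "P \<in> carrier_mat (n 0) (n 0)" and Ps: "\<And>i. i < length Ps \<Longrightarrow> Ps ! i \<in> carrier_mat (n (Suc i)) (n (Suc i))"
    using Cons.prems(1)[of 0] Cons.prems(1)[of "Suc _"] by auto
  have split: "kron A B $$ (a, b) = A $$ (a div N, b div N) * B $$ (a mod N, b mod N)"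
    if "A \<in> carrier_mat (n 0) (n 0)" "B \<in> carrier_mat N N" for A B
    using kron_index[of a A B b] that Cons.prems(3,4) unfolding prod by auto
  show ?case
  proof (cases j)
    case 0
    have "kron_list Ps \<in> carrier_mat N N" unfolding N_def using Ps by (rule kron_list_carrier)
    then show ?thesis using ab 0
      by (intro exI[of _ "kron_list Ps $$ (a mod N, b mod N)"] exI[of _ "a div N"] exI[of _ "b div N"])
        (simp add: split mult.commute)
  next
    case (Suc i)
    then have i: "i < length Ps" using Cons.prems(2) by simp
    obtain c u v where uv: "u < n (Suc i)" "v < n (Suc i)"
      and *: "\<And>Z. Z \<in> carrier_mat (n (Suc i)) (n (Suc i)) \<Longrightarrow>
        kron_list (Ps[i := Z]) $$ (a mod N, b mod N) = c * Z $$ (u, v)"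
      using Cons.IH[of "\<lambda>i. n (Suc i)" i "a mod N" "b mod N"] Ps i ab unfolding N_def by blast
    have "kron_list (Ps[i := Z]) \<in> carrier_mat N N" if "Z \<in> carrier_mat (n (Suc i)) (n (Suc i))" for Z
      unfolding N_def using Ps that by (rule kron_list_update_carrier)
    then show ?thesis using uv * P Suc
      by (intro exI[of _ "P $$ (a div N, b div N) * c"] exI[of _ u] exI[of _ v]) (simp add: split)
  qed
qed simp

section \<open>The matrices \<open>A_hat\<close>\<close>

lemma sum_eq_single:
  fixes f :: "'a \<Rightarrow> 'b :: comm_monoid_add"
  assumes "finite I" "u \<in> I" "\<And>i. i \<in> I \<Longrightarrow> i \<noteq> u \<Longrightarrow> f i = 0"
  shows "sum f I = f u"
  using assms by (simp add: sum.remove sum.neutral)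

lemma sum_sum_eq_single:
  fixes f :: "'a \<Rightarrow> 'c \<Rightarrow> 'b :: comm_monoid_add"
  assumes "finite I" "finite J" "u \<in> I" "v \<in> J"
    and "\<And>i j. i \<in> I \<Longrightarrow> j \<in> J \<Longrightarrow> i \<noteq> u \<or> j \<noteq> v \<Longrightarrow> f i j = 0"
  shows "(\<Sum>i\<in>I. \<Sum>j\<in>J. f i j) = f u v"
  using assms by (subst sum_eq_single[of I u]) (auto intro: sum.neutral sum_eq_single)

text \<open>For y = 0 the test matrix isolates one entry of \<open>B\<close>; for y =
  \<open>cnj x\<close> it is Hermitian. Adding the two units keeps the formula valid when a =
  b.\<close>

lemma mtrace_mult_two_units:
  assumes B: "B \<in> carrier_mat k k" and "a < k" "b < k"
  shows "mtrace (B * mat k k (\<lambda>ij. (if ij = (b, a) then x else 0) + (if ij = (a, b) then y else 0)))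
    = x * B $$ (a, b) + y * B $$ (b, a)"
proof -
  have *: "(\<Sum>i<k. \<Sum>j<k. B $$ (i, j) * (if (j, i) = (v, u) then z else 0)) = z * B $$ (u, v)"
    if "u < k" "v < k" for u v z
    using that by (subst sum_sum_eq_single[of "{..<k}" "{..<k}" u v]) auto
  show ?thesis
    using assms by (simp add: mtrace_mult[OF B] distrib_left sum.distrib * del: prod.inject)
qed

lemma mtrace_mult_eqD:
  assumes B: "B \<in> carrier_mat k k" and C: "C \<in> carrier_mat k k"
    and eq: "\<And>Z. Z \<in> carrier_mat k k \<Longrightarrow> mtrace (B * Z) = mtrace (C * Z)"
  shows "B = C"
proof (rule eq_matI)
  fix a b assume "a < dim_row C" "b < dim_col C"
  then have "a < k" "b < k" using C by auto
  then show "B $$ (a, b) = C $$ (a, b)"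
    using eq[of "mat k k (\<lambda>ij. (if ij = (b, a) then 1 else 0) + (if ij = (a, b) then 0 else 0))"]
    by (simp only: mtrace_mult_two_units[OF B] mtrace_mult_two_units[OF C]) simp
qed (use B C in auto)

text \<open>Serves to derive the Hermitian symmetry of \<open>A_hat\<close> from traces alone, by
  pairing with Hermitian matrices supported at (a, b) and (b, a).\<close>

lemma her_if_mtrace_mult_real:
  assumes B: "B \<in> carrier_mat k k"
    and real: "\<And>Z. Z \<in> her k \<Longrightarrow> Im (mtrace (B * Z)) = 0"
  shows "B \<in> her k"
  unfolding her_iff
proof (intro conjI B allI impI)
  fix a b assume ab: "a < k" "b < k"
  have "Im (x * B $$ (a, b) + cnj x * B $$ (b, a)) = 0" for x
  proof -
    let ?Z = "mat k k (\<lambda>ij. (if ij = (b, a) then x else 0) + (if ij = (a, b) then cnj x else 0))"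
    have "?Z $$ (j, i) = cnj (?Z $$ (i, j))" if "i < k" "j < k" for i j
    proof -
      have swap: "(j, i) = (b, a) \<longleftrightarrow> (i, j) = (a, b)" "(j, i) = (a, b) \<longleftrightarrow> (i, j) = (b, a)" by blast+
      have "(if p then x else 0) + (if q then cnj x else 0) = cnj ((if q then x else 0) + (if p then cnj x else 0))"
        for p q by simp
      then show ?thesis unfolding index_mat(1)[OF that] index_mat(1)[OF that(2,1)] swap .
    qed
    then have "?Z \<in> her k" unfolding her_iff by (intro conjI allI impI mat_carrier)
    then show ?thesis using real[of ?Z] by (simp only: mtrace_mult_two_units[OF B ab])
  qed
  \<comment> \<open>x = 1 makes the imaginary parts of the two mirrored entries opposite, x = \<i>
    makes their real parts equal.\<close>
  from this[of 1] this[of \<i>] show "B $$ (b, a) = cnj (B $$ (a, b))"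
    by (simp add: complex_eq_iff)
qed

lemma mtrace_representation:
  fixes w :: "'i \<Rightarrow> complex"
  assumes "finite I" "\<And>p. p \<in> I \<Longrightarrow> u p < k" "\<And>p. p \<in> I \<Longrightarrow> v p < k"
  obtains B where "B \<in> carrier_mat k k"
    "\<And>Z. Z \<in> carrier_mat k k \<Longrightarrow> mtrace (B * Z) = (\<Sum>p\<in>I. w p * Z $$ (u p, v p))"
proof
  \<comment> \<open>The weight of a term reading \<open>Z\<close> at (l, i) is collected at the
    transposed place (i, l), since tr(BZ) pairs these entries.\<close>
  let ?B = "mat k k (\<lambda>(i, l). \<Sum>p\<in>I. if u p = l \<and> v p = i then w p else 0)"
  show B: "?B \<in> carrier_mat k k" by simp
  fix Z :: "complex mat" assume Z: "Z \<in> carrier_mat k k"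
  have "mtrace (?B * Z) = (\<Sum>i<k. \<Sum>l<k. \<Sum>p\<in>I. (if u p = l \<and> v p = i then w p else 0) * Z $$ (l, i))"
    by (simp add: mtrace_mult[OF B Z] sum_distrib_right)
  also have "\<dots> = (\<Sum>i<k. \<Sum>p\<in>I. \<Sum>l<k. (if u p = l \<and> v p = i then w p else 0) * Z $$ (l, i))"
    by (intro sum.cong refl sum.swap)
  also have "\<dots> = (\<Sum>p\<in>I. \<Sum>i<k. \<Sum>l<k. (if u p = l \<and> v p = i then w p else 0) * Z $$ (l, i))"
    by (rule sum.swap)
  also have "\<dots> = (\<Sum>p\<in>I. w p * Z $$ (u p, v p))"
  proof (rule sum.cong[OF refl])
    fix p assume p: "p \<in> I"
    show "(\<Sum>i<k. \<Sum>l<k. (if u p = l \<and> v p = i then w p else 0) * Z $$ (l, i)) = w p * Z $$ (u p, v p)"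
      using assms(2,3)[OF p] by (subst sum_sum_eq_single[of "{..<k}" "{..<k}" "v p" "u p"]) auto
  qed
  finally show "mtrace (?B * Z) = (\<Sum>p\<in>I. w p * Z $$ (u p, v p))" .
qed

lemma her_prod_update: "Ps \<in> her_prod r n \<Longrightarrow> Z \<in> her (n j) \<Longrightarrow> Ps[j := Z] \<in> her_prod r n"
  by (cases "j < r") (auto simp: her_prod_def nth_list_update)

lemma A_hat:
  assumes A: "A \<in> her (\<Prod>j<r. n j)" and Ps: "Ps \<in> her_prod r n" and j: "j < r"
  shows "A_hat A Ps j \<in> her (n j)"
    and "\<And>Z. Z \<in> carrier_mat (n j) (n j) \<Longrightarrow> mtrace (A_hat A Ps j * Z) = mtrace (A * kron_list (Ps[j := Z]))"
proof -
  let ?N = "\<Prod>j<r. n j"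
  have len: "length Ps = r" and Psc: "\<And>i. i < r \<Longrightarrow> Ps ! i \<in> carrier_mat (n i) (n i)"
    using Ps by (auto simp: her_prod_def her_def)
  have "\<forall>p\<in>{..<?N} \<times> {..<?N}. \<exists>c u v. u < n j \<and> v < n j \<and>
    (\<forall>Z \<in> carrier_mat (n j) (n j). kron_list (Ps[j := Z]) $$ p = c * Z $$ (u, v))"
    using kron_list_update_index[of Ps n j] Psc j unfolding len by auto
  then obtain c u v where *: "\<And>p. p \<in> {..<?N} \<times> {..<?N} \<Longrightarrow> u p < n j \<and> v p < n j \<and>
    (\<forall>Z \<in> carrier_mat (n j) (n j). kron_list (Ps[j := Z]) $$ p = c p * Z $$ (u p, v p))"
    by (metis (no_types, lifting))
  let ?I = "{..<?N} \<times> {..<?N}"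
  \<comment> \<open>The pair p indexes an entry of the Kronecker product; in the trace it meets the
    entry of \<open>A\<close> at the swapped pair.\<close>
  obtain B where B: "B \<in> carrier_mat (n j) (n j)"
    and BZ: "\<And>Z. Z \<in> carrier_mat (n j) (n j) \<Longrightarrow> mtrace (B * Z) = (\<Sum>p\<in>?I. (A $$ (snd p, fst p) * c p) * Z $$ (u p, v p))"
    by (rule mtrace_representation[of ?I u "n j" v "\<lambda>p. A $$ (snd p, fst p) * c p"]) (use * in auto)
  have B': "mtrace (A * kron_list (Ps[j := Z])) = mtrace (B * Z)" if Z: "Z \<in> carrier_mat (n j) (n j)" for Z
  proof -
    have K: "kron_list (Ps[j := Z]) \<in> carrier_mat ?N ?N"
      using kron_list_update_carrier[of Ps n Z j] Psc Z by (simp add: len)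
    have "mtrace (A * kron_list (Ps[j := Z])) = (\<Sum>a<?N. \<Sum>b<?N. A $$ (a, b) * kron_list (Ps[j := Z]) $$ (b, a))"
      by (rule mtrace_mult[OF her_carrier[OF A] K])
    also have "\<dots> = (\<Sum>p\<in>?I. A $$ (snd p, fst p) * kron_list (Ps[j := Z]) $$ p)"
      by (subst sum.swap) (simp add: sum.cartesian_product case_prod_beta)
    also have "\<dots> = mtrace (B * Z)"
      unfolding BZ[OF Z] using * Z by (intro sum.cong refl) auto
    finally show ?thesis .
  qed
  have dim: "dim_row (Ps ! j) = n j" using Psc[OF j] by simp
  have "A_hat A Ps j = B"
    unfolding A_hat_def dim
  proof (rule the_equality)
    fix C assume "C \<in> carrier_mat (n j) (n j) \<and>
      (\<forall>Z\<in>carrier_mat (n j) (n j). mtrace (A * kron_list (Ps[j := Z])) = mtrace (C * Z))"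
    then show "C = B" using B B' by (intro mtrace_mult_eqD[of _ "n j"]) auto
  qed (use B B' in auto)
  then show "\<And>Z. Z \<in> carrier_mat (n j) (n j) \<Longrightarrow> mtrace (A_hat A Ps j * Z) = mtrace (A * kron_list (Ps[j := Z]))"
    using B' by simp
  \<comment> \<open>For Hermitian \<open>Z\<close> this trace is a value of the Rayleigh quotient on
    a Hermitian tuple, hence real.\<close>
  have "Im (mtrace (B * Z)) = 0" if Z: "Z \<in> her (n j)" for Z
    using rayleigh_eq_mtrace[OF A her_prod_update[OF Ps Z]] B'[OF her_carrier[OF Z]]
    by (metis Im_complex_of_real)
  then show "A_hat A Ps j \<in> her (n j)"
    unfolding \<open>A_hat A Ps j = B\<close> by (rule her_if_mtrace_mult_real[OF B])
qed

section \<open>Orthogonal projectors and invariant subspaces\<close>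

lemma mat_eqI_mult_vec:
  assumes A: "A \<in> carrier_mat m n" and B: "B \<in> carrier_mat m n"
    and eq: "\<And>v. v \<in> carrier_vec n \<Longrightarrow> A *\<^sub>v v = B *\<^sub>v (v :: 'a :: semiring_1 vec)"
  shows "A = B"
proof (rule mat_col_eqI)
  fix j assume "j < dim_col B"
  then have "j < n" using B by simp
  then have "A *\<^sub>v unit_vec n j = col A j" "B *\<^sub>v unit_vec n j = col B j"
    using A B by (auto intro!: eq_vecI simp: mult_mat_vec_def)
  then show "col A j = col B j" using eq[of "unit_vec n j"] by simp
qed (use A B in auto)

lemma vec_eq_if_minus_eq_0:
  fixes v w :: "'a :: group_add vec"
  assumes "v \<in> carrier_vec n" "w \<in> carrier_vec n" "v - w = 0\<^sub>v n"
  shows "v = w"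
proof (rule eq_vecI)
  fix i assume "i < dim_vec w"
  then show "vec_index v i = vec_index w i"
    using assms(1,2) arg_cong[OF assms(3), of "\<lambda>u. vec_index u i"] by simp
qed (use assms in simp)

lemma her_adjoint_scalar_prod:
  assumes A: "A \<in> her n" and u: "u \<in> carrier_vec n" and v: "v \<in> carrier_vec n"
  shows "u \<bullet>c (A *\<^sub>v v) = (A *\<^sub>v u) \<bullet>c v"
proof -
  have c: "A \<in> carrier_mat n n" using A by (rule her_carrier)
  have "u \<bullet>c (A *\<^sub>v v) = (\<Sum>i<n. \<Sum>j<n. u $ i * (cnj (A $$ (i, j)) * cnj (v $ j)))"
    using c u v by (simp add: scalar_prod_def lessThan_atLeast0 sum_distrib_left)
  also have "\<dots> = (\<Sum>i<n. \<Sum>j<n. u $ i * (A $$ (j, i) * cnj (v $ j)))"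
    by (intro sum.cong refl arg_cong2[where f = "(*)"]) (simp add: her_index[OF A, symmetric])
  also have "\<dots> = (\<Sum>j<n. \<Sum>i<n. u $ i * (A $$ (j, i) * cnj (v $ j)))"
    by (rule sum.swap)
  also have "\<dots> = (A *\<^sub>v u) \<bullet>c v"
    using c u v by (simp add: scalar_prod_def lessThan_atLeast0 sum_distrib_left sum_distrib_right mult_ac)
  finally show ?thesis .
qed

lemma mem_col_space_iff:
  fixes A :: "'a :: field mat"
  assumes "A \<in> carrier_mat n k"
  shows "w \<in> vec_space.col_space n A \<longleftrightarrow> w \<in> carrier_vec n \<and> (\<exists>x\<in>carrier_vec k. A *\<^sub>v x = w)"
proof -
  interpret vec_space "TYPE('a)" n .
  show ?thesis using assms by (auto simp: col_space_eq[OF assms])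
qed

text \<open>With a basis of the column space as the columns of \<open>F\<close> one has \<open>P = F C\<close> and \<open>C F = 1\<close>, so
  the trace of \<open>P\<close> is the trace of a unit matrix whose size is the dimension.\<close>

lemma idempotent_col_space_dim:
  assumes P: "P \<in> carrier_mat n n" and PP: "P * P = P" and tr: "mtrace P = of_nat m"
  shows "vec_subspace_of_dim n m (vec_space.col_space n P)"
proof -
  interpret vec_space "TYPE(complex)" n .
  define W where "W = col_space P"
  have W_iff: "w \<in> W \<longleftrightarrow> w \<in> carrier_vec n \<and> (\<exists>x\<in>carrier_vec n. P *\<^sub>v x = w)" for w
    by (simp only: W_def mem_col_space_iff[OF P])
  have cols: "set (cols P) \<subseteq> carrier_vec n" using P cols_dim by blast
  have sub: "subspace class_ring W V"
    unfolding W_def col_space_def by (rule span_is_subspace) (use cols in simp)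
  have fin: "vectorspace.fin_dim class_ring (vs W)"
    unfolding W_def col_space_def by (rule fin_dim_span_cols[OF P])
  note vsW = subspace_is_vs[OF sub]
  have subm: "submodule class_ring W V" using sub by (simp add: subspace_def)
  obtain b where b: "finite b" "vectorspace.basis class_ring (vs W) b"
    using vectorspace.finite_basis_exists[OF vsW fin] by blast
  \<comment> \<open>Independence and span inside \<open>W\<close> are restated in the ambient space,
    where the matrix lemmas apply.\<close>
  then have bW: "b \<subseteq> W" and li: "lin_indpt b" and sp: "span b = W"
    using span_li_not_depend[OF _ subm, of b] by (auto simp: vectorspace.basis_def[OF vsW])
  obtain bs where bs: "set bs = b" "distinct bs" using finite_distinct_list[OF b(1)] by blast
  define k where "k = length bs"
  have dim: "vectorspace.dim class_ring (vs W) = k"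
    using vectorspace.dim_basis[OF vsW b] bs distinct_card[OF bs(2)] by (simp add: k_def)
  define F where "F = mat_of_cols n bs"
  have F: "F \<in> carrier_mat n k" by (simp add: F_def k_def)
  have bn: "b \<subseteq> carrier_vec n" using bW W_iff by blast
  then have colsF: "cols F = bs" unfolding F_def using bs by (intro cols_mat_of_cols) simp
  have "\<exists>x\<in>carrier_vec k. F *\<^sub>v x = w" if "w \<in> W" for w
  proof -
    have "w \<in> col_space F" using that sp by (simp add: col_space_def colsF bs)
    then show ?thesis using F by (simp only: mem_col_space_iff[OF F])
  qed
  moreover have "col P j \<in> W" if "j < n" for j
    using that P cols span_mem[of "set (cols P)" "col P j"] by (auto simp: W_def col_space_def cols_def)
  ultimately have "\<forall>j\<in>{..<n}. \<exists>x. x \<in> carrier_vec k \<and> F *\<^sub>v x = col P j" by blast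
  then obtain x where x: "\<And>j. j < n \<Longrightarrow> x j \<in> carrier_vec k \<and> F *\<^sub>v x j = col P j"
    unfolding bchoice_iff by auto
  define C where "C = mat k n (\<lambda>(i, j). x j $ i)"
  have C: "C \<in> carrier_mat k n" by (simp add: C_def)
  have FC: "F * C = P"
  proof (rule mat_col_eqI)
    fix j assume "j < dim_col P"
    then have j: "j < n" using P by simp
    have "col C j = x j" using x[OF j] j by (auto simp: C_def)
    then show "col (F * C) j = col P j" unfolding col_mult2[OF F C j] using x[OF j] by simp
  qed (use F C P in auto)
  have PF: "P * F = F"
  proof (rule mat_col_eqI)
    fix j assume "j < dim_col F"
    then have j: "j < k" using F by simp
    then have "col F j \<in> W" using colsF bs bW F by (metis carrier_matD(2) cols_length cols_nth nth_mem subsetD)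
    then obtain y where y: "y \<in> carrier_vec n" "P *\<^sub>v y = col F j" unfolding W_iff by blast
    have "col (P * F) j = P *\<^sub>v (P *\<^sub>v y)" unfolding col_mult2[OF P F j] y(2) ..
    also have "\<dots> = (P * P) *\<^sub>v y" using P y by simp
    finally show "col (P * F) j = col F j" using PP y by simp
  qed (use F P in auto)
  have inj: "v = 0\<^sub>v k" if v: "v \<in> carrier_vec k" and "F *\<^sub>v v = 0\<^sub>v n" for v
    using lin_depI[OF F v _ that(2)] colsF bs li by auto
  \<comment> \<open>F C F = P F = F, and \<open>F\<close> cancels on the left because its columns
    are independent.\<close>
  have CF: "C * F = 1\<^sub>m k"
  proof (rule mat_eqI_mult_vec[of _ k k])
    fix v :: "complex vec" assume v: "v \<in> carrier_vec k"
    have "F *\<^sub>v (C *\<^sub>v (F *\<^sub>v v)) = P *\<^sub>v (F *\<^sub>v v)"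
      unfolding FC[symmetric] by (rule assoc_mult_mat_vec[OF F C mult_mat_vec_carrier[OF F v], symmetric])
    also have "\<dots> = F *\<^sub>v v"
      unfolding assoc_mult_mat_vec[OF P F v, symmetric] PF ..
    finally have "F *\<^sub>v (C *\<^sub>v (F *\<^sub>v v) - v) = 0\<^sub>v n"
      using F C v by (simp add: mult_minus_distrib_mat_vec[of _ n k])
    then have "C *\<^sub>v (F *\<^sub>v v) - v = 0\<^sub>v k" using F C v by (intro inj) auto
    then have "C *\<^sub>v (F *\<^sub>v v) = v"
      using F C v by (auto intro: vec_eq_if_minus_eq_0[of _ k])
    then show "(C * F) *\<^sub>v v = 1\<^sub>m k *\<^sub>v v" using F C v by simp
  qed (use F C in auto)
  have "of_nat m = mtrace (C * F)"
    unfolding tr[symmetric] FC[symmetric] by (rule mtrace_mult_commute[OF F C])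
  then have "m = k" by (simp add: CF mtrace_one)
  then show ?thesis
    using sub dim unfolding vec_subspace_of_dim_def W_def by simp
qed

text \<open>A Hermitian \<open>P\<close> moves across the inner product, where idempotence makes it
  annihilate v - Pv.\<close>

lemma projector_onto_col_space:
  assumes P: "P \<in> her n" and PP: "P * P = P"
  shows "orthogonal_projector_onto n P (vec_space.col_space n P)"
proof -
  have c: "P \<in> carrier_mat n n" using P by (rule her_carrier)
  note W_iff = mem_col_space_iff[OF c]
  have "(v - P *\<^sub>v v) \<bullet>c w = 0" if v: "v \<in> carrier_vec n" and w: "w \<in> vec_space.col_space n P" for v w
  proof -
    obtain x where x: "x \<in> carrier_vec n" "w = P *\<^sub>v x" using w unfolding W_iff by blast
    have "P *\<^sub>v (v - P *\<^sub>v v) = P *\<^sub>v v - (P * P) *\<^sub>v v"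
      using c v by (simp add: mult_minus_distrib_mat_vec[of _ n n])
    also have "\<dots> = 0\<^sub>v n" using c v by (simp add: PP)
    finally show ?thesis
      unfolding x(2) using c v x(1) by (subst her_adjoint_scalar_prod[OF P]) auto
  qed
  moreover have "P *\<^sub>v v \<in> vec_space.col_space n P" if "v \<in> carrier_vec n" for v
    using that c unfolding W_iff by auto
  ultimately show ?thesis using c by (simp add: orthogonal_projector_onto_def)
qed

text \<open>The vector w - Pw lies in \<open>W\<close> and is orthogonal to \<open>W\<close>, hence
  orthogonal to itself.\<close>

lemma projector_fixes_range:
  assumes P: "orthogonal_projector_onto n P W" and W: "vec_subspace_of_dim n k W" and w: "w \<in> W"
  shows "P *\<^sub>v w = w"
proof -
  have subm: "submodule class_ring W (module_vec TYPE(complex) n)"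
    using W by (simp add: vec_subspace_of_dim_def subspace_def)
  have wc: "w \<in> carrier_vec n"
    using submodule.subset[OF subm] w by (auto simp: module_vec_simps)
  have c: "P \<in> carrier_mat n n" using P by (simp add: orthogonal_projector_onto_def)
  have Pw: "P *\<^sub>v w \<in> W" "P *\<^sub>v w \<in> carrier_vec n"
    using P wc c by (auto simp: orthogonal_projector_onto_def)
  have "(-1) \<cdot>\<^sub>v (P *\<^sub>v w) \<in> W"
    using submodule.smult_closed[OF subm, of "-1"] Pw by (simp add: module_vec_simps class_ring_simps)
  then have "w + (-1) \<cdot>\<^sub>v (P *\<^sub>v w) \<in> W"
    using submodule.m_closed[OF subm w] by (simp add: module_vec_simps)
  moreover have "w + (-1) \<cdot>\<^sub>v (P *\<^sub>v w) = w - P *\<^sub>v w" using wc Pw by (intro eq_vecI) auto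
  ultimately have "(w - P *\<^sub>v w) \<bullet>c (w - P *\<^sub>v w) = 0"
    using P wc by (auto simp: orthogonal_projector_onto_def)
  then have "w - P *\<^sub>v w = 0\<^sub>v n" using wc Pw by (simp add: conjugate_square_eq_0_vec[of _ n])
  then have "w = P *\<^sub>v w" by (rule vec_eq_if_minus_eq_0[OF wc Pw(2)])
  then show ?thesis by simp
qed

text \<open>If \<open>P\<close> and \<open>B\<close> commute, the range of \<open>P\<close> serves
  as \<open>W\<close>. Conversely, invariance only says PBP = BP; Hermitian symmetry supplies the
  mirrored identity.\<close>

lemma commutator_0_iff_invariant:
  assumes P: "P \<in> Gr m n" and B: "B \<in> her n"
  shows "commutator P B = 0\<^sub>m n n \<longleftrightarrow>
    (\<exists>W. vec_subspace_of_dim n m W \<and> invariant_subspace B W \<and> orthogonal_projector_onto n P W)"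
proof
  note c = her_carrier[OF Gr_imp_her[OF P]] her_carrier[OF B]
  assume 0: "commutator P B = 0\<^sub>m n n"
  have PB: "P * B = B * P"
  proof (rule eq_matI)
    fix i j assume ij: "i < dim_row (B * P)" "j < dim_col (B * P)"
    then have "(P * B - B * P) $$ (i, j) = 0" using 0 c by (simp add: commutator_def)
    then show "(P * B) $$ (i, j) = (B * P) $$ (i, j)" using ij by (simp del: index_mult_mat(1))
  qed (use c in auto)
  let ?W = "vec_space.col_space n P"
  have "B *\<^sub>v w \<in> ?W" if w: "w \<in> ?W" for w
  proof -
    obtain x where x: "x \<in> carrier_vec n" "w = P *\<^sub>v x"
      using w c by (auto simp: mem_col_space_iff[OF c(1)])
    then have "B *\<^sub>v w = P *\<^sub>v (B *\<^sub>v x)" using c by (metis PB assoc_mult_mat_vec)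
    then show ?thesis using c x by (auto simp: mem_col_space_iff[OF c(1)])
  qed
  then show "\<exists>W. vec_subspace_of_dim n m W \<and> invariant_subspace B W \<and> orthogonal_projector_onto n P W"
    using P idempotent_col_space_dim[of P n m] projector_onto_col_space[of P n]
    by (intro exI[of _ ?W]) (auto simp: Gr_def her_def invariant_subspace_def)
next
  note c = her_carrier[OF Gr_imp_her[OF P]] her_carrier[OF B]
  assume "\<exists>W. vec_subspace_of_dim n m W \<and> invariant_subspace B W \<and> orthogonal_projector_onto n P W"
  then obtain W where W: "vec_subspace_of_dim n m W" "invariant_subspace B W" "orthogonal_projector_onto n P W"
    by blast
  have BP: "P * (B * P) = B * P"
  proof (rule mat_eqI_mult_vec[of _ n n])
    fix v :: "complex vec" assume v: "v \<in> carrier_vec n"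
    then have "P *\<^sub>v v \<in> W" using W(3) by (simp add: orthogonal_projector_onto_def)
    then have "B *\<^sub>v (P *\<^sub>v v) \<in> W" using W(2) by (simp add: invariant_subspace_def)
    then have "P *\<^sub>v (B *\<^sub>v (P *\<^sub>v v)) = B *\<^sub>v (P *\<^sub>v v)" by (rule projector_fixes_range[OF W(3,1)])
    then show "(P * (B * P)) *\<^sub>v v = (B * P) *\<^sub>v v"
      using c v by (simp add: assoc_mult_mat_vec[of _ n n _ n])
  qed (use c in auto)
  have h: "mat_adjoint P = P" "mat_adjoint B = B" using P B by (auto simp: Gr_def her_def)
  \<comment> \<open>The adjoint of PBP = BP is PBP = PB, so PB = BP.\<close>
  have "mat_adjoint (P * (B * P)) = mat_adjoint (B * P)" by (simp only: BP)
  then have "P * B * P = P * B"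
    using c h by (simp add: mat_adjoint_mult[of _ n n _ n])
  then have "P * B = B * P" using BP c by simp
  then show "commutator P B = 0\<^sub>m n n" using c by (simp add: commutator_def)
qed

section \<open>The gradient of the generalized Rayleigh quotient\<close>

lemma Gr_prod_imp_her_prod: "P \<in> Gr_prod r m n \<Longrightarrow> P \<in> her_prod r n"
  by (auto simp: Gr_prod_def her_prod_def intro: Gr_imp_her)

lemma tangent_space_Gr_prodI:
  assumes P: "P \<in> Gr_prod r m n" and \<xi>: "\<xi> \<in> her_prod r n"
    and T: "\<And>j. j < r \<Longrightarrow> P ! j * \<xi> ! j + \<xi> ! j * P ! j = \<xi> ! j"
  shows "\<xi> \<in> tangent_space r n (Gr_prod r m n) P"
proof -
  have len: "length P = r" and Pj: "\<And>j. j < r \<Longrightarrow> P ! j \<in> Gr (m j) (n j)"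
    using P by (auto simp: Gr_prod_def)
  have \<xi>j: "\<And>j. j < r \<Longrightarrow> \<xi> ! j \<in> her (n j)" using \<xi> by (auto simp: her_prod_def)
  \<comment> \<open>Bundling all properties of a factor curve lets interval and curve be chosen
    simultaneously for every index.\<close>
  define Q where "Q j \<epsilon> \<gamma> \<longleftrightarrow> \<epsilon> > 0 \<and> (\<forall>t \<in> {-\<epsilon><..<\<epsilon>}. \<gamma> t \<in> Gr (m j) (n j)) \<and>
    (\<forall>a<n j. \<forall>b<n j. (\<lambda>t. \<gamma> t $$ (a, b)) C1_differentiable_on {-\<epsilon><..<\<epsilon>}) \<and> \<gamma> 0 = P ! j \<and>
    (\<forall>a<n j. \<forall>b<n j. ((\<lambda>t. \<gamma> t $$ (a, b)) has_vector_derivative (\<xi> ! j) $$ (a, b)) (at 0))"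
    for j and \<epsilon> :: real and \<gamma>
  have "\<exists>\<epsilon> \<gamma>. Q j \<epsilon> \<gamma>" if "j < r" for j
  proof (rule Gr_curve[OF Pj[OF that] \<xi>j[OF that] T[OF that]])
    fix \<epsilon> \<gamma>
    assume "\<epsilon> > 0" "\<And>t. t \<in> {-\<epsilon><..<\<epsilon>} \<Longrightarrow> \<gamma> t \<in> Gr (m j) (n j)"
      "\<And>a b. a < n j \<Longrightarrow> b < n j \<Longrightarrow> (\<lambda>t. \<gamma> t $$ (a, b)) C1_differentiable_on {-\<epsilon><..<\<epsilon>}"
      "\<gamma> 0 = P ! j"
      "\<And>a b. a < n j \<Longrightarrow> b < n j \<Longrightarrow>
        ((\<lambda>t. \<gamma> t $$ (a, b)) has_vector_derivative (\<xi> ! j) $$ (a, b)) (at 0)"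
    then have "Q j \<epsilon> \<gamma>" unfolding Q_def by blast
    then show ?thesis by blast
  qed
  then obtain e g where Q: "\<And>j. j < r \<Longrightarrow> Q j (e j) (g j)" by metis
  \<comment> \<open>The common interval is the smallest one; the added 1 keeps the minimum defined
    for r = 0.\<close>
  define \<epsilon> where "\<epsilon> = Min (insert 1 (e ` {..<r}))"
  have \<epsilon>: "\<epsilon> > 0" using Q by (auto simp: \<epsilon>_def Q_def)
  have "\<epsilon> \<le> e j" if "j < r" for j using that by (auto simp: \<epsilon>_def)
  then have sub: "{-\<epsilon><..<\<epsilon>} \<subseteq> {-e j<..<e j}" if "j < r" for j using that by fastforce
  let ?\<gamma> = "\<lambda>t. map (\<lambda>j. g j t) [0..<r]"
  have "?\<gamma> t \<in> Gr_prod r m n" if "t \<in> {-\<epsilon><..<\<epsilon>}" for t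
  proof -
    have "g j t \<in> Gr (m j) (n j)" if "j < r" for j
      using Q[OF that] sub[OF that] \<open>t \<in> _\<close> unfolding Q_def by blast
    then show ?thesis by (simp add: Gr_prod_def)
  qed
  moreover have "(\<lambda>t. (?\<gamma> t ! j) $$ (a, b)) C1_differentiable_on {-\<epsilon><..<\<epsilon>}"
    if "j < r" "a < n j" "b < n j" for j a b
  proof -
    have "(\<lambda>t. g j t $$ (a, b)) C1_differentiable_on {-e j<..<e j}"
      using Q[OF that(1)] that unfolding Q_def by blast
    then show ?thesis using C1_differentiable_on_subset sub[OF that(1)] that(1) by simp
  qed
  moreover have "?\<gamma> 0 = P"
    using Q len by (intro nth_equalityI) (auto simp: Q_def)
  moreover have "((\<lambda>t. (?\<gamma> t ! j) $$ (a, b)) has_vector_derivative (\<xi> ! j) $$ (a, b)) (at 0)"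
    if "j < r" "a < n j" "b < n j" for j a b
    using Q[OF that(1)] that by (simp add: Q_def)
  ultimately have "curve_with_velocity r n (Gr_prod r m n) P \<xi> ?\<gamma>"
    unfolding curve_with_velocity_def using \<epsilon> by blast
  then show ?thesis using \<xi> unfolding tangent_space_def by blast
qed

lemma rayleigh_has_derivative_along:
  assumes A: "A \<in> her (\<Prod>j<r. n j)" and P: "P \<in> Gr_prod r m n" and \<xi>: "\<xi> \<in> her_prod r n"
    and \<gamma>: "curve_with_velocity r n (Gr_prod r m n) P \<xi> \<gamma>"
  shows "((\<lambda>t. rayleigh A (\<gamma> t)) has_real_derivative
    (\<Sum>j<r. Re (mtrace (A_hat A P j * \<xi> ! j)))) (at 0)"
proof -
  let ?N = "\<Prod>j<r. n j"
  have P': "P \<in> her_prod r n" using P by (rule Gr_prod_imp_her_prod)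
  have len: "length P = r" and Pc: "\<And>j. j < r \<Longrightarrow> P ! j \<in> carrier_mat (n j) (n j)"
    and \<xi>c: "\<And>j. j < r \<Longrightarrow> \<xi> ! j \<in> carrier_mat (n j) (n j)"
    using P' \<xi> by (auto simp: her_prod_def her_def)
  obtain \<epsilon> where \<epsilon>: "\<epsilon> > 0" "\<And>t. t \<in> {-\<epsilon><..<\<epsilon>} \<Longrightarrow> \<gamma> t \<in> Gr_prod r m n"
    using \<gamma> unfolding curve_with_velocity_def by blast
  have \<gamma>0: "\<gamma> 0 = P"
    and d: "\<And>j a b. j < r \<Longrightarrow> a < n j \<Longrightarrow> b < n j \<Longrightarrow>
      ((\<lambda>t. (\<gamma> t ! j) $$ (a, b)) has_vector_derivative (\<xi> ! j) $$ (a, b)) (at 0)"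
    using \<gamma> unfolding curve_with_velocity_def by auto
  \<comment> \<open>The Leibniz rule wants matrices of the right size at every t, but \<gamma> is
    controlled only near 0. \<open>G\<close> has that size throughout and agrees with \<gamma> near
    0.\<close>
  define G where "G j t = mat (n j) (n j) (\<lambda>ab. (\<gamma> t ! j) $$ ab)" for j t
  define K where "K t = kron_list (map (\<lambda>j. G j t) [0..<r])" for t
  have G\<gamma>: "map (\<lambda>j. G j t) [0..<r] = \<gamma> t" if "t \<in> {-\<epsilon><..<\<epsilon>}" for t
    using Gr_prod_imp_her_prod[OF \<epsilon>(2)[OF that]]
    by (intro nth_equalityI) (auto simp: G_def her_prod_def her_def intro!: eq_matI)
  have Gd: "((\<lambda>t. G j t $$ (a, b)) has_vector_derivative (\<xi> ! j) $$ (a, b)) (at 0)"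
    if "j < r" "a < n j" "b < n j" for j a b
    using d[OF that] that by (simp add: G_def)
  have Kd: "((\<lambda>t. K t $$ (a, b)) has_vector_derivative (\<Sum>j<r. kron_list (P[j := \<xi> ! j]) $$ (a, b))) (at 0)"
    if "a < ?N" "b < ?N" for a b
    using kron_list_has_vector_derivative[where G = G and X = "\<lambda>j. \<xi> ! j" and n = n and s = 0, OF _ \<xi>c Gd that]
      G\<gamma>[of 0] \<epsilon>(1) by (simp add: G_def K_def \<gamma>0)
  have Kc: "K t \<in> carrier_mat ?N ?N" for t
    unfolding K_def using kron_list_carrier[of "map (\<lambda>j. G j t) [0..<r]" n] by (simp add: G_def)
  have "((\<lambda>t. \<Sum>a<?N. \<Sum>b<?N. A $$ (a, b) * K t $$ (b, a)) has_vector_derivative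
      (\<Sum>a<?N. \<Sum>b<?N. A $$ (a, b) * (\<Sum>j<r. kron_list (P[j := \<xi> ! j]) $$ (b, a)))) (at 0)"
    by (intro has_vector_derivative_sum has_vector_derivative_mult_right Kd) auto
  also have "(\<Sum>a<?N. \<Sum>b<?N. A $$ (a, b) * (\<Sum>j<r. kron_list (P[j := \<xi> ! j]) $$ (b, a)))
      = (\<Sum>j<r. \<Sum>a<?N. \<Sum>b<?N. A $$ (a, b) * kron_list (P[j := \<xi> ! j]) $$ (b, a))"
    by (simp only: sum_distrib_left sum.swap[of _ "{..<r}"])
  also have "\<dots> = (\<Sum>j<r. mtrace (A_hat A P j * \<xi> ! j))"
  proof (rule sum.cong[OF refl])
    fix j assume "j \<in> {..<r}"
    then have j: "j < r" by simp
    have "kron_list (P[j := \<xi> ! j]) \<in> carrier_mat ?N ?N"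
      using kron_list_update_carrier[of P n "\<xi> ! j" j] Pc \<xi>c[OF j] by (simp add: len)
    from mtrace_mult[OF her_carrier[OF A] this]
    show "(\<Sum>a<?N. \<Sum>b<?N. A $$ (a, b) * kron_list (P[j := \<xi> ! j]) $$ (b, a)) = mtrace (A_hat A P j * \<xi> ! j)"
      using A_hat(2)[OF A P' j \<xi>c[OF j]] by simp
  qed
  also have "(\<lambda>t. \<Sum>a<?N. \<Sum>b<?N. A $$ (a, b) * K t $$ (b, a)) = (\<lambda>t. mtrace (A * K t))"
    by (rule ext) (rule mtrace_mult[OF her_carrier[OF A] Kc, symmetric])
  finally have "((\<lambda>t. Re (mtrace (A * K t))) has_vector_derivative
      Re (\<Sum>j<r. mtrace (A_hat A P j * \<xi> ! j))) (at 0)"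
    by (rule bounded_linear.has_vector_derivative[OF bounded_linear_Re])
  then have "((\<lambda>t. rayleigh A (\<gamma> t)) has_vector_derivative Re (\<Sum>j<r. mtrace (A_hat A P j * \<xi> ! j))) (at 0)"
    by (rule has_vector_derivative_transform_within_open[where S = "{-\<epsilon><..<\<epsilon>}"])
      (use \<epsilon>(1) G\<gamma> in \<open>auto simp: rayleigh_def K_def\<close>)
  then show ?thesis by (simp add: has_real_derivative_iff_has_vector_derivative)
qed

section \<open>Definiteness of the inner product and uniqueness of gradients\<close>

lemma her_mtrace_square:
  assumes X: "X \<in> her n"
  shows "Re (mtrace (X * X)) = (\<Sum>i<n. \<Sum>j<n. (cmod (X $$ (i, j)))\<^sup>2)"
proof -
  have "X $$ (i, j) * X $$ (j, i) = of_real ((cmod (X $$ (i, j)))\<^sup>2)" if "i < n" "j < n" for i j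
    unfolding her_index[OF X that] complex_norm_square ..
  then have "mtrace (X * X) = (\<Sum>i<n. \<Sum>j<n. of_real ((cmod (X $$ (i, j)))\<^sup>2))"
    unfolding mtrace_mult[OF her_carrier[OF X] her_carrier[OF X]] by (intro sum.cong refl) simp
  then show ?thesis by simp
qed

lemma her_inner_self_eq_0:
  assumes X: "X \<in> her_prod r n" and 0: "her_inner X X = 0" and j: "j < r"
  shows "X ! j = 0\<^sub>m (n j) (n j)"
proof -
  have len: "length X = r" and Xj: "\<And>j. j < r \<Longrightarrow> X ! j \<in> her (n j)"
    using X by (auto simp: her_prod_def)
  have nonneg: "0 \<le> Re (mtrace (X ! i * X ! i))" if "i < r" for i
    unfolding her_mtrace_square[OF Xj[OF that]] by (intro sum_nonneg) simp
  have "Re (mtrace (X ! j * X ! j)) = 0"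
    using 0 j nonneg unfolding her_inner_def len by (subst (asm) sum_nonneg_eq_0_iff) auto
  then have "(cmod ((X ! j) $$ (a, b)))\<^sup>2 = 0" if "a < n j" "b < n j" for a b
    using that unfolding her_mtrace_square[OF Xj[OF j]]
    by (subst (asm) sum_nonneg_eq_0_iff) (auto intro: sum_nonneg simp: sum_nonneg_eq_0_iff)
  then show ?thesis using her_carrier[OF Xj[OF j]] by (intro eq_matI) auto
qed

text \<open>The two equations make the norm of X - Y vanish. They pair only with \<open>X\<close>
  and \<open>Y\<close>, because two gradients are known to be tangent while their difference is
  not.\<close>

lemma her_inner_eq_imp_eq:
  assumes X: "X \<in> her_prod r n" and Y: "Y \<in> her_prod r n"
    and eq: "her_inner X X = her_inner Y X" "her_inner X Y = her_inner Y Y"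
  shows "X = Y"
proof (rule nth_equalityI)
  have len: "length X = r" "length Y = r" using X Y by (auto simp: her_prod_def)
  then show "length X = length Y" by simp
  have c: "X ! j \<in> carrier_mat (n j) (n j)" "Y ! j \<in> carrier_mat (n j) (n j)" if "j < r" for j
    using X Y that by (auto simp: her_prod_def her_def)
  define D where "D = map (\<lambda>j. X ! j - Y ! j) [0..<r]"
  have D: "D \<in> her_prod r n"
    using X Y by (simp add: D_def her_prod_def her_minus)
  have "her_inner D D = (\<Sum>j<r. Re (mtrace (X ! j * X ! j)) - Re (mtrace (X ! j * Y ! j))
      - (Re (mtrace (Y ! j * X ! j)) - Re (mtrace (Y ! j * Y ! j))))"
    unfolding her_inner_def
  proof (rule sum.cong)
    fix j assume "j \<in> {..<r}"
    then have j: "j < r" by simp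
    have "mtrace ((X ! j - Y ! j) * (X ! j - Y ! j))
      = mtrace (X ! j * X ! j) - mtrace (X ! j * Y ! j) - (mtrace (Y ! j * X ! j) - mtrace (Y ! j * Y ! j))"
      using c[OF j] by (simp add: square_distrib[of _ "n j"] square_mult[of _ "n j"] mtrace_minus[of _ "n j"])
    then show "Re (mtrace (D ! j * D ! j)) = Re (mtrace (X ! j * X ! j)) - Re (mtrace (X ! j * Y ! j))
      - (Re (mtrace (Y ! j * X ! j)) - Re (mtrace (Y ! j * Y ! j)))"
      using j by (simp add: D_def)
  qed (simp add: D_def)
  also have "\<dots> = 0"
    using eq by (simp add: her_inner_def len sum_subtractf)
  finally have D0: "her_inner D D = 0" .
  fix j assume "j < length X"
  then have j: "j < r" using len by simp
  have "X ! j - Y ! j = 0\<^sub>m (n j) (n j)"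
    using her_inner_self_eq_0[OF D D0 j] j by (simp add: D_def)
  then have "(X ! j - Y ! j) $$ (a, b) = 0" if "a < n j" "b < n j" for a b using that by simp
  then show "X ! j = Y ! j" using c[OF j] by (intro eq_matI) auto
qed

text \<open>A tangent vector comes with at least one curve, so the quantification over curves in
  \<open>has_differential\<close> is not vacuous.\<close>

lemma has_differential_unique:
  assumes "\<xi> \<in> tangent_space r n M P" "has_differential r n M f P \<xi> d" "has_differential r n M f P \<xi> d'"
  shows "d = d'"
  using assms unfolding tangent_space_def has_differential_def by (blast intro: DERIV_unique)

lemma is_gradient_unique:
  assumes G: "is_gradient r n M f P G" and H: "is_gradient r n M f P H"
  shows "G = H"
proof -
  have "her_inner G \<xi> = her_inner H \<xi>" if "\<xi> \<in> tangent_space r n M P" for \<xi>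
    using has_differential_unique[OF that] G H that unfolding is_gradient_def by blast
  then show ?thesis
    using G H by (intro her_inner_eq_imp_eq[of _ r n]) (auto simp: is_gradient_def tangent_space_def)
qed

section \<open>Gradient and critical points\<close>

lemma is_gradient_rayleigh:
  assumes A: "A \<in> her (\<Prod>j<r. n j)" and P: "P \<in> Gr_prod r m n"
  shows "is_gradient r n (Gr_prod r m n) (rayleigh A) P (map (\<lambda>j. ad2 (P ! j) (A_hat A P j)) [0..<r])"
    (is "is_gradient r n ?M _ P ?G")
proof -
  have P': "P \<in> her_prod r n" using P by (rule Gr_prod_imp_her_prod)
  have Pj: "P ! j \<in> her (n j)" "P ! j \<in> carrier_mat (n j) (n j)" "P ! j * P ! j = P ! j" if "j < r" for j
    using P that by (auto simp: Gr_prod_def Gr_def her_def)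
  note hat = A_hat(1)[OF A P']
  have "?G \<in> tangent_space r n ?M P"
    using Pj hat ad2_tangent[OF Pj(2) her_carrier[OF hat] Pj(3)]
    by (intro tangent_space_Gr_prodI[OF P]) (simp_all add: her_prod_def ad2_her)
  moreover have "has_differential r n ?M (rayleigh A) P \<xi> (her_inner ?G \<xi>)"
    if \<xi>: "\<xi> \<in> tangent_space r n ?M P" for \<xi>
    unfolding has_differential_def
  proof (intro allI impI)
    fix \<gamma> assume \<gamma>: "curve_with_velocity r n ?M P \<xi> \<gamma>"
    have \<xi>': "\<xi> \<in> her_prod r n" using \<xi> by (simp add: tangent_space_def)
    \<comment> \<open>The curve \<gamma> forces \<xi> to satisfy the tangency equation, so
      \<open>ad2\<close> can be shifted onto \<xi> and absorbed there.\<close>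
    have "mtrace (ad2 (P ! j) (A_hat A P j) * \<xi> ! j) = mtrace (A_hat A P j * \<xi> ! j)" if j: "j < r" for j
    proof -
      have \<xi>j: "\<xi> ! j \<in> carrier_mat (n j) (n j)" using \<xi>' j by (simp add: her_prod_def her_def)
      show ?thesis
        unfolding mtrace_ad2_adjoint[OF Pj(2)[OF j] \<xi>j her_carrier[OF hat[OF j]] Pj(3)[OF j]]
          ad2_tangent_fix[OF Pj(2)[OF j] \<xi>j Pj(3)[OF j] curve_velocity_tangent[OF \<gamma> \<xi>j Pj(2)[OF j] j]] ..
    qed
    then have "her_inner ?G \<xi> = (\<Sum>j<r. Re (mtrace (A_hat A P j * \<xi> ! j)))"
      by (simp add: her_inner_def)
    then show "((\<lambda>t. rayleigh A (\<gamma> t)) has_real_derivative her_inner ?G \<xi>) (at 0)"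
      using rayleigh_has_derivative_along[OF A P \<xi>' \<gamma>] by simp
  qed
  ultimately show ?thesis unfolding is_gradient_def by blast
qed

text \<open>The gradient is itself tangent, so at a critical point its pairing with itself is 0 and
  definiteness applies.\<close>

lemma critical_point_iff_gradient_0:
  assumes "P \<in> M" and G: "is_gradient r n M f P G"
  shows "critical_point r n M f P \<longleftrightarrow> (\<forall>j<r. G ! j = 0\<^sub>m (n j) (n j))"
proof
  have Gd: "has_differential r n M f P \<xi> (her_inner G \<xi>)"
    if "\<xi> \<in> tangent_space r n M P" for \<xi>
    using G that by (auto simp: is_gradient_def)
  have Gt: "G \<in> tangent_space r n M P" using G by (simp add: is_gradient_def)
  then have Gh: "G \<in> her_prod r n" by (simp add: tangent_space_def)
  {
    assume "critical_point r n M f P"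
    then have "has_differential r n M f P G 0" using Gt by (simp add: critical_point_def)
    then have "her_inner G G = 0" using has_differential_unique[OF Gt Gd[OF Gt]] by simp
    then show "\<forall>j<r. G ! j = 0\<^sub>m (n j) (n j)" using her_inner_self_eq_0[OF Gh] by blast
  next
    assume 0: "\<forall>j<r. G ! j = 0\<^sub>m (n j) (n j)"
    have "her_inner G \<xi> = 0" if \<xi>: "\<xi> \<in> her_prod r n" for \<xi>
      unfolding her_inner_def
    proof (rule sum.neutral, intro ballI)
      fix j assume "j \<in> {..<length G}"
      then have j: "j < r" using Gh by (simp add: her_prod_def)
      then have "\<xi> ! j \<in> carrier_mat (n j) (n j)" using \<xi> by (simp add: her_prod_def her_def)
      then show "Re (mtrace (G ! j * \<xi> ! j)) = 0" using 0 j by (simp add: mtrace_def)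
    qed
    then have "has_differential r n M f P \<xi> 0" if "\<xi> \<in> tangent_space r n M P" for \<xi>
      using Gd[OF that] that by (simp add: tangent_space_def)
    then show "critical_point r n M f P" using assms(1) by (simp add: critical_point_def)
  }
qed

theorem theorem3p7:
  fixes r :: nat and m n :: "nat \<Rightarrow> nat" and A :: "complex mat" and P :: "complex mat list"
  assumes "r \<ge> 1"
    and "\<And>j. j < r \<Longrightarrow> 1 \<le> m j \<and> m j \<le> n j"
    and "A \<in> her (\<Prod>j<r. n j)"
    and "P \<in> Gr_prod r m n"
  shows "((\<exists>!G. is_gradient r n (Gr_prod r m n) (rayleigh A) P G) \<and>
          grad r n (Gr_prod r m n) (rayleigh A) P = map (\<lambda>j. ad2 (P ! j) (A_hat A P j)) [0..<r])
       \<and> (critical_point r n (Gr_prod r m n) (rayleigh A) P \<longleftrightarrow>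
          (\<forall>j<r. commutator (P ! j) (A_hat A P j) = 0\<^sub>m (n j) (n j)))
       \<and> (critical_point r n (Gr_prod r m n) (rayleigh A) P \<longleftrightarrow>
          (\<forall>j<r. \<exists>W. vec_subspace_of_dim (n j) (m j) W \<and> invariant_subspace (A_hat A P j) W \<and>
                     orthogonal_projector_onto (n j) (P ! j) W))"
proof -
  note G = is_gradient_rayleigh[OF assms(3,4)]
  note hat = A_hat(1)[OF assms(3) Gr_prod_imp_her_prod[OF assms(4)]]
  have Pj: "P ! j \<in> Gr (m j) (n j)" if "j < r" for j
    using assms(4) that by (simp add: Gr_prod_def)
  have ad2: "ad2 (P ! j) (A_hat A P j) = 0\<^sub>m (n j) (n j)
      \<longleftrightarrow> commutator (P ! j) (A_hat A P j) = 0\<^sub>m (n j) (n j)" if j: "j < r" for j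
    using Pj[OF j] her_carrier[OF hat[OF j]] by (intro ad2_eq_0_iff) (auto simp: Gr_def)
  have "grad r n (Gr_prod r m n) (rayleigh A) P = map (\<lambda>j. ad2 (P ! j) (A_hat A P j)) [0..<r]"
    unfolding grad_def using G by (rule the_equality) (rule is_gradient_unique[OF _ G])
  moreover have "\<exists>!G. is_gradient r n (Gr_prod r m n) (rayleigh A) P G"
    using G is_gradient_unique by blast
  moreover have crit: "critical_point r n (Gr_prod r m n) (rayleigh A) P \<longleftrightarrow>
      (\<forall>j<r. commutator (P ! j) (A_hat A P j) = 0\<^sub>m (n j) (n j))"
    unfolding critical_point_iff_gradient_0[OF assms(4) G] by (simp add: ad2)
  moreover have "commutator (P ! j) (A_hat A P j) = 0\<^sub>m (n j) (n j) \<longleftrightarrow>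
      (\<exists>W. vec_subspace_of_dim (n j) (m j) W \<and> invariant_subspace (A_hat A P j) W \<and>
        orthogonal_projector_onto (n j) (P ! j) W)" if "j < r" for j
    by (rule commutator_0_iff_invariant[OF Pj[OF that] hat[OF that]])
  ultimately show ?thesis by simp
qed

end
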